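(* Let $\gamma>0$ and $1<p<\infty$. The Bessel potential of order $\gamma$, $\mathcal{J}_\gamma^{\alpha,\beta}$, defined on polynomials $f$ by $\mathcal{J}_\gamma^{\alpha,\beta}f=\sum_{n=0}^\infty (1+r_n)^{-\gamma/2}J_n^{\alpha,\beta}f$, admits a continuous extension to $L^p([-1,1]^d,\mu^d_{\alpha,\beta})$.
   Context: $\mathbb{N}=\{0,1,2,\dots\}$. Fix $d\ge 1$ and $\alpha=(\alpha_1,\dots,\alpha_d),\ \beta=(\beta_1,\dots,\beta_d)\in\mathbb{R}^d$ with $\alpha_i,\beta_i>-\frac12$ for all $i$. The normalized Jacobi measure on $[-1,1]^d$ is the probability measure $\mu^d_{\alpha,\beta}(dx)=\prod_{i=1}^d \frac{1}{2^{\alpha_i+\beta_i+1}B(\alpha_i+1,\beta_i+1)}(1-x_i)^{\alpha_i}(1+x_i)^{\beta_i}dx_i$, where $B$ is the Beta function. For $n\in\mathbb{N}$ and real $a,b>-1$, $p_n^{a,b}$ is the one-dimensional Jacobi polynomial of degree $n$, given by Rodrigues' formula $(1-x)^a(1+x)^b c_n p_n^{a,b}(x)=\frac{(-1)^n}{2^n n!}\frac{d^n}{dx^n}\{(1-x)^{a+n}(1+x)^{b+n}\}$, with constant $c_n>0$ chosen so that $p_n^{a,b}$ has $L^2$ norm $1$ with respect to the one-dimensional normalized Jacobi measure. For $\kappa=(\kappa_1,\dots,\kappa_d)\in\mathbb{N}^d$ put $\vec p_\kappa^{\,\alpha,\beta}(x)=\prod_{i=1}^d p_{\kappa_i}^{\alpha_i,\beta_i}(x_i)$;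 these form an orthonormal basis of $L^2([-1,1]^d,\mu^d_{\alpha,\beta})$. Put $\lambda_\kappa=\sum_{i=1}^d\kappa_i(\kappa_i+\alpha_i+\beta_i+1)$. The set $\{\lambda_\kappa:\kappa\in\mathbb{N}^d\}$ is written in increasing order as $\{r_n\}_{n=0}^\infty$, $0=r_0<r_1<r_2<\cdots$, and $A_n^{\alpha,\beta}=\{\kappa\in\mathbb{N}^d:\lambda_\kappa=r_n\}$. $J_n^{\alpha,\beta}$ is the orthogonal projection of $L^2([-1,1]^d,\mu^d_{\alpha,\beta})$ onto the span of $\{\vec p_\kappa^{\,\alpha,\beta}:\kappa\in A_n^{\alpha,\beta}\}$, i.e. $J_n^{\alpha,\beta}f=\sum_{\kappa\in A_n^{\alpha,\beta}}\hat f(\kappa)\,\vec p_\kappa^{\,\alpha,\beta}$ with $\hat f(\kappa)=\int_{[-1,1]^d} f\,\vec p_\kappa^{\,\alpha,\beta}\,d\mu^d_{\alpha,\beta}$. The Jacobi operator is $\mathcal{L}^{\alpha,\beta}=\sum_{i=1}^d\big[(1-x_i^2)\frac{\partial^2}{\partial x_i^2}+(\beta_i-\alpha_i-(\alpha_i+\beta_i+2)x_i)\frac{\partial}{\partial x_i}\big]$, with $\mathcal{L}^{\alpha,\beta}\vec p_\kappa^{\,\alpha,\beta}=-\lambda_\kappa\vec p_\kappa^{\,\alpha,\beta}$. The Bessel potential is $\mathcal{J}_\gamma^{\alpha,\beta}=(I-\mathcal{L}^{\alpha,\beta})^{-\gamma/2}$, which on polynomials is the sum in the claim. *)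

theory Defs
  imports "HOL-Analysis.Analysis"
begin

definition jacobi_density :: "real \<Rightarrow> real \<Rightarrow> real \<Rightarrow> real" where
  "jacobi_density a b x =
     indicator {-1..1} x * ((1 - x) powr a * (1 + x) powr b)
       / (2 powr (a + b + 1) * Beta (a + 1) (b + 1))"

definition jacobi_measure1 :: "real \<Rightarrow> real \<Rightarrow> real measure" where
  "jacobi_measure1 a b = density lborel (\<lambda>x. ennreal (jacobi_density a b x))"

text \<open>The measure lives on the whole Euclidean space, with a density that vanishes
  outside the cube, so functions count only through their values on the cube.\<close>

definition jacobi_measure :: "real ^ 'd::finite \<Rightarrow> real ^ 'd \<Rightarrow> (real ^ 'd) measure" where
  "jacobi_measure \<alpha> \<beta> =
     density lborel (\<lambda>x. ennreal (\<Prod>i\<in>UNIV. jacobi_density (\<alpha> $ i) (\<beta> $ i) (x $ i)))"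

text \<open>Rodrigues' formula is required on the open interval only: the powers may be singular
  at the endpoints, and a polynomial is determined by its values inside. For \<open>a, b > -1\<close>
  there is exactly one such polynomial.\<close>

definition jacobi_poly :: "nat \<Rightarrow> real \<Rightarrow> real \<Rightarrow> real poly" where
  "jacobi_poly n a b =
     (THE q. (\<exists>c>0. \<forall>x\<in>{-1<..<1}.
                (1 - x) powr a * (1 + x) powr b * c * poly q x =
                  (-1) ^ n / (2 ^ n * fact n) *
                  (deriv ^^ n) (\<lambda>t. (1 - t) powr (a + real n) * (1 + t) powr (b + real n)) x)
           \<and> (\<integral>x. (poly q x)\<^sup>2 \<partial>jacobi_measure1 a b) = 1)"

definition jacobi_vec :: "real ^ 'd::finite \<Rightarrow> real ^ 'd \<Rightarrow> nat ^ 'd \<Rightarrow> real ^ 'd \<Rightarrow> real" where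
  "jacobi_vec \<alpha> \<beta> \<kappa> x = (\<Prod>i\<in>UNIV. poly (jacobi_poly (\<kappa> $ i) (\<alpha> $ i) (\<beta> $ i)) (x $ i))"

definition jacobi_eigenvalue :: "real ^ 'd::finite \<Rightarrow> real ^ 'd \<Rightarrow> nat ^ 'd \<Rightarrow> real" where
  "jacobi_eigenvalue \<alpha> \<beta> \<kappa> =
     (\<Sum>i\<in>UNIV. real (\<kappa> $ i) * (real (\<kappa> $ i) + \<alpha> $ i + \<beta> $ i + 1))"

text \<open>The enumeration exists and is unique when all \<open>\<alpha> $ i + \<beta> $ i > -1\<close>: the set of
  eigenvalues is then infinite and has only finitely many elements below any bound.\<close>

definition jacobi_level :: "real ^ 'd::finite \<Rightarrow> real ^ 'd \<Rightarrow> nat \<Rightarrow> real" where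
  "jacobi_level \<alpha> \<beta> = (THE r. strict_mono r \<and> range r = range (jacobi_eigenvalue \<alpha> \<beta>))"

definition jacobi_index_set :: "real ^ 'd::finite \<Rightarrow> real ^ 'd \<Rightarrow> nat \<Rightarrow> (nat ^ 'd) set" where
  "jacobi_index_set \<alpha> \<beta> n = {\<kappa>. jacobi_eigenvalue \<alpha> \<beta> \<kappa> = jacobi_level \<alpha> \<beta> n}"

definition jacobi_coeff ::
  "real ^ 'd::finite \<Rightarrow> real ^ 'd \<Rightarrow> (real ^ 'd \<Rightarrow> real) \<Rightarrow> nat ^ 'd \<Rightarrow> real" where
  "jacobi_coeff \<alpha> \<beta> f \<kappa> = (\<integral>x. f x * jacobi_vec \<alpha> \<beta> \<kappa> x \<partial>jacobi_measure \<alpha> \<beta>)"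

definition jacobi_proj ::
  "real ^ 'd::finite \<Rightarrow> real ^ 'd \<Rightarrow> nat \<Rightarrow> (real ^ 'd \<Rightarrow> real) \<Rightarrow> real ^ 'd \<Rightarrow> real" where
  "jacobi_proj \<alpha> \<beta> n f x =
     (\<Sum>\<kappa>\<in>jacobi_index_set \<alpha> \<beta> n. jacobi_coeff \<alpha> \<beta> f \<kappa> * jacobi_vec \<alpha> \<beta> \<kappa> x)"

text \<open>Meant for polynomial \<open>f\<close>, where only finitely many terms of the series are nonzero.\<close>

definition bessel_potential ::
  "real ^ 'd::finite \<Rightarrow> real ^ 'd \<Rightarrow> real \<Rightarrow> (real ^ 'd \<Rightarrow> real) \<Rightarrow> real ^ 'd \<Rightarrow> real" where
  "bessel_potential \<alpha> \<beta> \<gamma> f x =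
     (\<Sum>n. (1 + jacobi_level \<alpha> \<beta> n) powr (- \<gamma> / 2) * jacobi_proj \<alpha> \<beta> n f x)"

definition Lp_space :: "real \<Rightarrow> 'a measure \<Rightarrow> ('a \<Rightarrow> real) set" where
  "Lp_space p M = {f \<in> borel_measurable M. integrable M (\<lambda>x. \<bar>f x\<bar> powr p)}"

definition Lp_norm :: "real \<Rightarrow> 'a measure \<Rightarrow> ('a \<Rightarrow> real) \<Rightarrow> real" where
  "Lp_norm p M f = (\<integral>x. \<bar>f x\<bar> powr p \<partial>M) powr (1 / p)"

text \<open>A continuous linear operator on the Lp space, acting on representatives: identities
  between functions hold almost everywhere. Continuity implies that almost everywhere equal
  arguments have almost everywhere equal images.\<close>

definition continuous_Lp_operator ::
  "real \<Rightarrow> 'a measure \<Rightarrow> (('a \<Rightarrow> real) \<Rightarrow> 'a \<Rightarrow> real) \<Rightarrow> bool" where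
  "continuous_Lp_operator p M T \<longleftrightarrow>
     (\<forall>f\<in>Lp_space p M. T f \<in> Lp_space p M) \<and>
     (\<forall>f\<in>Lp_space p M. \<forall>g\<in>Lp_space p M. \<forall>a b.
        AE x in M. T (\<lambda>y. a * f y + b * g y) x = a * T f x + b * T g x) \<and>
     (\<forall>f\<in>Lp_space p M. \<forall>\<epsilon>>0. \<exists>\<delta>>0. \<forall>g\<in>Lp_space p M.
        Lp_norm p M (\<lambda>x. g x - f x) < \<delta> \<longrightarrow> Lp_norm p M (\<lambda>x. T g x - T f x) < \<epsilon>)"

end

theory Submission
  imports Defs
begin

text \<open>
  On polynomials the Bessel potential is a Fourier multiplier: it multiplies the coefficient of
  the Jacobi polynomial with index \<open>\<kappa>\<close> by \<open>(1 + \<lambda>\<^sub>\<kappa>) powr (- \<gamma> / 2)\<close>. The whole proof consists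
  in showing that this multiplier does not increase the \<open>p\<close>-th power integral; polynomials being
  dense in the \<open>L\<^sup>p\<close> space of the Jacobi measure, the operator then extends
  (\<open>Lp_operator_extension\<close>, \<open>polynomials_dense_Lp\<close>).

  The analytic input is dissipativity: integration by parts gives
  \<open>\<integral> sgn f \<bar>f\<bar> powr (p - 1) * L f d\<mu> \<le> 0\<close>, because the factor in front of \<open>L f\<close> is a nondecreasing
  function of \<open>f\<close> and the flux \<open>(1 - x) powr (a + 1) * (1 + x) powr (b + 1) * f'\<close> vanishes at the end points
  (\<open>jacobi_operator_dissipative\<close>; by Fubini it is enough to treat one coordinate at a time). With the
  tangent line inequality for \<open>\<bar>t\<bar> powr p\<close> this says that every resolvent, that is, every
  multiplier \<open>1 / (1 + s \<lambda>\<^sub>\<kappa>)\<close> with \<open>s \<ge> 0\<close>, is a contraction (\<open>contractive_resolvent\<close>).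

  Contractive multipliers are closed under powers, subconvex combinations and pointwise limits,
  and the Bessel multiplier is reached in this way from resolvents (\<open>contractive_bessel\<close>): put
  \<open>r = 1 / (1 + \<lambda> / n)\<close>. The number \<open>n (1 - r) = \<lambda> / (1 + \<lambda> / n)\<close> tends to \<open>\<lambda>\<close> (the Yosida
  approximation of \<open>- L\<close>), while for \<open>\<sigma> > 0\<close> the binomial series writes
  \<open>(1 + n (1 - r)) powr (- \<sigma>) = (n + 1) powr (- \<sigma>) * (1 - n r / (n + 1)) powr (- \<sigma>)\<close> as a series in
  powers of \<open>r\<close> whose coefficients are nonnegative and, as \<open>r = 1\<close> shows, have sum \<open>1\<close>.

  To see that the potential acts as a multiplier, Rodrigues' formula is turned into a recursion
  by an operator that intertwines the Jacobi operators with parameters \<open>(a + 1, b + 1)\<close> and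
  \<open>(a, b)\<close>. The recursion yields the degree and the eigenvalue equation, and the symmetry of the
  Jacobi operator makes eigenfunctions with different eigenvalues orthogonal.
\<close>

section \<open>Elementary inequalities for powers\<close>

text \<open>
  The convex function \<open>\<bar>t\<bar> powr p\<close> lies above its tangent at \<open>u\<close>; after multiplying out this is Young's
  inequality for \<open>\<bar>v\<bar>\<close> and \<open>\<bar>u\<bar> powr (p - 1)\<close>.
\<close>

lemma abs_powr_tangent:
  fixes p u v :: real
  assumes "1 < p"
  shows "\<bar>u\<bar> powr p + p * (sgn u * \<bar>u\<bar> powr (p - 1)) * (v - u) \<le> \<bar>v\<bar> powr p"
proof -
  define q where "q = p / (p - 1)"
  have q: "1 < q" "1 / p + 1 / q = 1" "(p - 1) * q = p" "1 / q = (p - 1) / p"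
    using assms by (auto simp: q_def field_simps)
  have "\<bar>v\<bar> * \<bar>u\<bar> powr (p - 1) \<le> \<bar>v\<bar> powr p / p + (\<bar>u\<bar> powr (p - 1)) powr q / q"
    using Youngs_inequality[of p q "\<bar>v\<bar>" "\<bar>u\<bar> powr (p - 1)"] assms q by auto
  also have "(\<bar>u\<bar> powr (p - 1)) powr q / q = \<bar>u\<bar> powr p * ((p - 1) / p)"
    using q by (simp add: powr_powr divide_inverse)
  finally have "p * (\<bar>v\<bar> * \<bar>u\<bar> powr (p - 1)) \<le> p * (\<bar>v\<bar> powr p / p + \<bar>u\<bar> powr p * ((p - 1) / p))"
    using assms by (intro mult_left_mono) auto
  also have "\<dots> = \<bar>v\<bar> powr p + (p - 1) * \<bar>u\<bar> powr p"
    using assms by (simp add: field_simps)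
  finally have 1: "p * (\<bar>v\<bar> * \<bar>u\<bar> powr (p - 1)) \<le> \<bar>v\<bar> powr p + (p - 1) * \<bar>u\<bar> powr p" .
  have "sgn u * v \<le> \<bar>v\<bar>"
    by (auto simp: sgn_real_def)
  then have 2: "p * \<bar>u\<bar> powr (p - 1) * (sgn u * v) \<le> p * \<bar>u\<bar> powr (p - 1) * \<bar>v\<bar>"
    using assms by (intro mult_left_mono) auto
  have 3: "sgn u * \<bar>u\<bar> powr (p - 1) * u = \<bar>u\<bar> powr p"
  proof (cases "u = 0")
    case False
    then have "sgn u * \<bar>u\<bar> powr (p - 1) * u = \<bar>u\<bar> powr (p - 1) * \<bar>u\<bar> powr 1"
      by (auto simp: sgn_real_def)
    then show ?thesis
      by (simp only: powr_add[symmetric]) simp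
  qed simp
  have 4: "p * (sgn u * \<bar>u\<bar> powr (p - 1)) * (v - u)
      = p * \<bar>u\<bar> powr (p - 1) * (sgn u * v) - p * (sgn u * \<bar>u\<bar> powr (p - 1) * u)"
    by (simp add: algebra_simps)
  show ?thesis
    using 1 2 unfolding 4 3 by (simp add: algebra_simps)
qed

text \<open>
  Jensen's inequality for \<open>\<bar>t\<bar> powr p\<close>, from the tangent at the weighted mean \<open>u\<close>. Weights of
  total mass below one are completed by the mass \<open>1 - sum w K\<close> at the point \<open>0\<close>, where the
  function vanishes.
\<close>

lemma abs_powr_sum_le:
  fixes w v :: "'i \<Rightarrow> real" and p :: real
  assumes "1 < p" "finite K" "\<And>j. j \<in> K \<Longrightarrow> 0 \<le> w j" "sum w K \<le> 1"
  shows "\<bar>\<Sum>j\<in>K. w j * v j\<bar> powr p \<le> (\<Sum>j\<in>K. w j * \<bar>v j\<bar> powr p)"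
proof -
  define u where "u = (\<Sum>j\<in>K. w j * v j)"
  define c where "c = p * (sgn u * \<bar>u\<bar> powr (p - 1))"
  define s where "s = 1 - sum w K"
  have tan: "\<bar>u\<bar> powr p + c * (y - u) \<le> \<bar>y\<bar> powr p" for y
    unfolding c_def by (rule abs_powr_tangent[OF assms(1)])
  have h1: "(\<Sum>j\<in>K. w j * (\<bar>u\<bar> powr p + c * (v j - u))) \<le> (\<Sum>j\<in>K. w j * \<bar>v j\<bar> powr p)"
    by (intro sum_mono mult_left_mono tan assms)
  have h2: "(\<Sum>j\<in>K. w j * (\<bar>u\<bar> powr p + c * (v j - u)))
      = sum w K * \<bar>u\<bar> powr p + c * u - sum w K * (c * u)"
  proof -
    have "(\<Sum>j\<in>K. w j * (A + c * (v j - u))) = sum w K * A + c * (\<Sum>j\<in>K. w j * v j) - sum w K * (c * u)" for A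
      by (simp add: sum_distrib_left sum_distrib_right sum.distrib sum_subtractf algebra_simps)
    then show ?thesis by (simp add: u_def[symmetric])
  qed
  have h3: "s * (\<bar>u\<bar> powr p + c * (0 - u)) \<le> s * \<bar>0::real\<bar> powr p"
    using assms by (intro mult_left_mono tan) (auto simp: s_def)
  show ?thesis
    unfolding u_def[symmetric] using h1 h3 assms(1) unfolding h2 by (simp add: s_def algebra_simps)
qed

text \<open>
  A substitute for the triangle inequality. The constant is harmless below: it enters only
  estimates that are used qualitatively, for limits and continuity.
\<close>

lemma abs_powr_add_le:
  fixes u v p :: real
  assumes "0 \<le> p"
  shows "\<bar>u + v\<bar> powr p \<le> 2 powr p * (\<bar>u\<bar> powr p + \<bar>v\<bar> powr p)"
proof -
  have "\<bar>u + v\<bar> powr p \<le> (2 * max \<bar>u\<bar> \<bar>v\<bar>) powr p"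
    using assms by (intro powr_mono2) auto
  also have "\<dots> = 2 powr p * (max \<bar>u\<bar> \<bar>v\<bar>) powr p"
    by (simp add: powr_mult)
  also have "\<dots> \<le> 2 powr p * (\<bar>u\<bar> powr p + \<bar>v\<bar> powr p)"
    by (intro mult_left_mono) (auto simp: max_def)
  finally show ?thesis .
qed

section \<open>Integrals of \<open>p\<close>-th powers\<close>

text \<open>
  The \<open>p\<close>-th power of the \<open>L\<^sup>p\<close> norm, which is additive over the measure and therefore more
  convenient than the norm itself.
\<close>

definition pmass :: "real \<Rightarrow> 'a measure \<Rightarrow> ('a \<Rightarrow> real) \<Rightarrow> real" where
  "pmass p M f = (\<integral>x. \<bar>f x\<bar> powr p \<partial>M)"

lemma pmass_nonneg: "0 \<le> pmass p M f"
  unfolding pmass_def by simp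

lemma pmass_zero: "pmass p M (\<lambda>x. 0) = 0"
  by (simp add: pmass_def)

lemma pmass_diff_commute: "pmass p M (\<lambda>x. f x - g x) = pmass p M (\<lambda>x. g x - f x)"
  unfolding pmass_def by (simp add: abs_minus_commute)

lemma Lp_spaceD:
  assumes "f \<in> Lp_space p M"
  shows "f \<in> borel_measurable M" "integrable M (\<lambda>x. \<bar>f x\<bar> powr p)"
  using assms by (auto simp: Lp_space_def)

lemma Lp_norm_less_iff:
  assumes "0 < p" "0 < e"
  shows "Lp_norm p M f < e \<longleftrightarrow> pmass p M f < e powr p"
proof -
  have "e = (e powr p) powr (1 / p)"
    using assms by (simp add: powr_powr)
  then have "Lp_norm p M f < e \<longleftrightarrow> pmass p M f powr (1 / p) < (e powr p) powr (1 / p)"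
    unfolding Lp_norm_def pmass_def by simp
  also have "\<dots> \<longleftrightarrow> pmass p M f < e powr p"
    using assms pmass_nonneg[of p M f] powr_less_mono2[of "1/p" "pmass p M f" "e powr p"]
      powr_mono2[of "1/p" "e powr p" "pmass p M f"] by (auto simp: not_less[symmetric])
  finally show ?thesis .
qed

lemma Lp_space_lincomb:
  assumes f: "f \<in> Lp_space p M" and g: "g \<in> Lp_space p M" and p: "0 \<le> p"
  shows "(\<lambda>x. a * f x + b * g x) \<in> Lp_space p M"
proof -
  note [measurable] = Lp_spaceD(1)[OF f] Lp_spaceD(1)[OF g]
  have "integrable M (\<lambda>x. 2 powr p * (\<bar>a\<bar> powr p * \<bar>f x\<bar> powr p + \<bar>b\<bar> powr p * \<bar>g x\<bar> powr p))"
    using Lp_spaceD(2)[OF f] Lp_spaceD(2)[OF g] by auto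
  then have "integrable M (\<lambda>x. \<bar>a * f x + b * g x\<bar> powr p)"
    by (rule Bochner_Integration.integrable_bound)
      (use abs_powr_add_le[OF p] in \<open>auto simp: abs_mult powr_mult intro!: AE_I2 order_trans[OF abs_powr_add_le[OF p]]\<close>)
  then show ?thesis
    by (auto simp: Lp_space_def)
qed

lemma Lp_space_diff:
  assumes "f \<in> Lp_space p M" "g \<in> Lp_space p M" "0 \<le> p"
  shows "(\<lambda>x. f x - g x) \<in> Lp_space p M"
  using Lp_space_lincomb[OF assms, of 1 "-1"] by simp

lemma Lp_space_add:
  assumes "f \<in> Lp_space p M" "g \<in> Lp_space p M" "0 \<le> p"
  shows "(\<lambda>x. f x + g x) \<in> Lp_space p M"
  using Lp_space_lincomb[OF assms, of 1 1] by simp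

lemma pmass_lincomb_le:
  assumes f: "f \<in> Lp_space p M" and g: "g \<in> Lp_space p M" and p: "0 \<le> p"
  shows "pmass p M (\<lambda>x. a * f x + b * g x)
    \<le> 2 powr p * (\<bar>a\<bar> powr p * pmass p M f + \<bar>b\<bar> powr p * pmass p M g)"
proof -
  have "pmass p M (\<lambda>x. a * f x + b * g x)
    \<le> (\<integral>x. 2 powr p * (\<bar>a\<bar> powr p * \<bar>f x\<bar> powr p + \<bar>b\<bar> powr p * \<bar>g x\<bar> powr p) \<partial>M)"
    unfolding pmass_def
  proof (rule integral_mono)
    show "integrable M (\<lambda>x. \<bar>a * f x + b * g x\<bar> powr p)"
      using Lp_space_lincomb[OF f g p] by (rule Lp_spaceD)
    show "integrable M (\<lambda>x. 2 powr p * (\<bar>a\<bar> powr p * \<bar>f x\<bar> powr p + \<bar>b\<bar> powr p * \<bar>g x\<bar> powr p))"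
      using Lp_spaceD(2)[OF f] Lp_spaceD(2)[OF g] by auto
  qed (use abs_powr_add_le[OF p] in \<open>auto simp: abs_mult powr_mult intro!: order_trans[OF abs_powr_add_le[OF p]]\<close>)
  also have "\<dots> = 2 powr p * (\<bar>a\<bar> powr p * pmass p M f + \<bar>b\<bar> powr p * pmass p M g)"
    unfolding pmass_def using Lp_spaceD(2)[OF f] Lp_spaceD(2)[OF g] by simp
  finally show ?thesis .
qed

lemma pmass_add_le:
  assumes "f \<in> Lp_space p M" "g \<in> Lp_space p M" "0 \<le> p"
  shows "pmass p M (\<lambda>x. f x + g x) \<le> 2 powr p * (pmass p M f + pmass p M g)"
  using pmass_lincomb_le[OF assms, of 1 1] by simp

lemma pmass_eq_0_imp_AE:
  assumes "f \<in> Lp_space p M" "pmass p M f \<le> 0"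
  shows "AE x in M. f x = 0"
proof -
  have "pmass p M f = 0"
    using assms pmass_nonneg[of p M f] by simp
  then have "AE x in M. \<bar>f x\<bar> powr p = 0"
    using integral_nonneg_eq_0_iff_AE[OF Lp_spaceD(2)[OF assms(1)]] by (auto simp: pmass_def)
  then show ?thesis by auto
qed

section \<open>Completeness and extension of bounded operators\<close>

text \<open>
  Completeness in the form needed for extending operators: the Cauchy condition is so strong that
  the increments are summable in mean, hence the sequence converges almost everywhere, and
  Fatou's lemma carries the estimates over to the limit.
\<close>

lemma Lp_complete:
  fixes g :: "nat \<Rightarrow> 'a \<Rightarrow> real"
  assumes fin: "finite_measure M" and p: "1 \<le> p"
    and g: "\<And>n. g n \<in> Lp_space p M"
    and cauchy: "\<And>n m. n \<le> m \<Longrightarrow> pmass p M (\<lambda>x. g m x - g n x) \<le> ((1/2) ^ n) powr p"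
  shows "\<exists>h\<in>Lp_space p M. \<forall>n. pmass p M (\<lambda>x. h x - g n x) \<le> ((1/2) ^ n) powr p"
proof -
  interpret finite_measure M by (rule fin)
  have [measurable]: "g n \<in> borel_measurable M" for n
    using g by (rule Lp_spaceD)
  define c where "c = measure M (space M) + 1"
  have c0: "c \<ge> 0" by (simp add: c_def)
  \<comment> \<open>Since \<open>x \<le> 1 + x\<^sup>p\<close>, a small mass makes the increments summable in mean.\<close>
  have inc: "(\<integral>\<^sup>+x. ennreal \<bar>g (Suc n) x - g n x\<bar> \<partial>M) \<le> ennreal (c * (1/2) ^ n)" for n
  proof -
    let ?s = "(1/2::real) ^ n"
    have int: "integrable M (\<lambda>x. \<bar>g (Suc n) x - g n x\<bar> powr p)"
      using Lp_space_diff[OF g g, of "Suc n" n] p by (auto dest: Lp_spaceD)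
    have ptw: "\<bar>y\<bar> \<le> ?s + ?s / ?s powr p * \<bar>y\<bar> powr p" for y :: real
    proof -
      have "\<bar>y\<bar> / ?s \<le> 1 + (\<bar>y\<bar> / ?s) powr p"
      proof (cases "\<bar>y\<bar> / ?s \<le> 1")
        case False
        then have "(\<bar>y\<bar> / ?s) powr 1 \<le> (\<bar>y\<bar> / ?s) powr p"
          using p by (intro powr_mono) auto
        then show ?thesis by simp
      qed (auto intro: add_increasing2)
      then have "?s * (\<bar>y\<bar> / ?s) \<le> ?s * (1 + (\<bar>y\<bar> / ?s) powr p)"
        by (intro mult_left_mono) auto
      then show ?thesis
        by (simp add: powr_divide algebra_simps)
    qed
    have "(\<integral>\<^sup>+x. ennreal \<bar>g (Suc n) x - g n x\<bar> \<partial>M)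
       \<le> (\<integral>\<^sup>+x. ennreal (?s + ?s / ?s powr p * \<bar>g (Suc n) x - g n x\<bar> powr p) \<partial>M)"
      by (intro nn_integral_mono ennreal_leI ptw)
    also have "\<dots> = ennreal (\<integral>x. ?s + ?s / ?s powr p * \<bar>g (Suc n) x - g n x\<bar> powr p \<partial>M)"
      using int by (intro nn_integral_eq_integral) auto
    also have "(\<integral>x. ?s + ?s / ?s powr p * \<bar>g (Suc n) x - g n x\<bar> powr p \<partial>M)
       = ?s * measure M (space M) + ?s / ?s powr p * pmass p M (\<lambda>x. g (Suc n) x - g n x)"
      using int by (simp add: pmass_def)
    also have "\<dots> \<le> ?s * measure M (space M) + ?s / ?s powr p * (?s powr p)"
      by (intro add_mono mult_left_mono cauchy) auto
    also have "\<dots> = c * ?s"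
      by (simp add: c_def algebra_simps)
    finally show ?thesis by (simp add: ennreal_leI)
  qed
  have "(\<integral>\<^sup>+x. (\<Sum>n. ennreal \<bar>g (Suc n) x - g n x\<bar>) \<partial>M)
      = (\<Sum>n. \<integral>\<^sup>+x. ennreal \<bar>g (Suc n) x - g n x\<bar> \<partial>M)"
    by (intro nn_integral_suminf) auto
  also have "\<dots> \<le> (\<Sum>n. ennreal (c * (1/2) ^ n))"
    by (intro suminf_le inc) auto
  also have "\<dots> = ennreal (\<Sum>n. c * (1/2) ^ n)"
    using c0 by (intro suminf_ennreal2) (auto intro!: summable_mult summable_geometric)
  finally have "(\<integral>\<^sup>+x. (\<Sum>n. ennreal \<bar>g (Suc n) x - g n x\<bar>) \<partial>M) \<noteq> \<infinity>"
    by (auto simp: top_unique)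
  then have "AE x in M. (\<Sum>n. ennreal \<bar>g (Suc n) x - g n x\<bar>) \<noteq> \<infinity>"
    by (intro nn_integral_noteq_infinite) auto
  then have conv: "AE x in M. convergent (\<lambda>n. g n x)"
  proof eventually_elim
    case (elim x)
    then have "summable (\<lambda>n. \<bar>g (Suc n) x - g n x\<bar>)"
      by (intro summable_suminf_not_top) auto
    then have "summable (\<lambda>n. g (Suc n) x - g n x)"
      by (rule summable_rabs_cancel)
    then have "convergent (\<lambda>n. \<Sum>i<n. g (Suc i) x - g i x)"
      by (simp add: summable_iff_convergent)
    then have "convergent (\<lambda>n. g n x - g 0 x)"
      unfolding sum_lessThan_telescope[of "\<lambda>i. g i x"] .
    then show ?case
      using convergent_add_const_right_iff[of "\<lambda>n. g n x" "- g 0 x"] by simp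
  qed
  define h where "h = (\<lambda>x. lim (\<lambda>n. g n x))"
  have [measurable]: "h \<in> borel_measurable M"
    unfolding h_def by (rule borel_measurable_lim_metric) auto
  have bound: "(\<integral>\<^sup>+x. ennreal (\<bar>h x - g n x\<bar> powr p) \<partial>M) \<le> ennreal (((1/2) ^ n) powr p)" for n
  proof -
    have "(\<integral>\<^sup>+x. ennreal (\<bar>h x - g n x\<bar> powr p) \<partial>M)
       = (\<integral>\<^sup>+x. liminf (\<lambda>m. ennreal (\<bar>g m x - g n x\<bar> powr p)) \<partial>M)"
      using conv
    proof (intro nn_integral_cong_AE, eventually_elim)
      case (elim x)
      then have "(\<lambda>m. g m x) \<longlonglongrightarrow> h x"
        unfolding h_def by (simp add: convergent_LIMSEQ_iff)
      then have "(\<lambda>m. ennreal (\<bar>g m x - g n x\<bar> powr p)) \<longlonglongrightarrow> ennreal (\<bar>h x - g n x\<bar> powr p)"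
        using p by (intro tendsto_intros tendsto_ennrealI tendsto_powr') auto
      then show ?case
        by (intro lim_imp_Liminf[symmetric]) auto
    qed
    also have "\<dots> \<le> liminf (\<lambda>m. \<integral>\<^sup>+x. ennreal (\<bar>g m x - g n x\<bar> powr p) \<partial>M)"
      by (intro nn_integral_liminf) auto
    also have "\<dots> \<le> ennreal (((1/2) ^ n) powr p)"
    proof (rule Liminf_le)
      show "\<forall>\<^sub>F m in sequentially. (\<integral>\<^sup>+x. ennreal (\<bar>g m x - g n x\<bar> powr p) \<partial>M)
          \<le> ennreal (((1/2) ^ n) powr p)"
        using eventually_ge_at_top[of n]
      proof eventually_elim
        case (elim m)
        have "integrable M (\<lambda>x. \<bar>g m x - g n x\<bar> powr p)"
          using Lp_space_diff[OF g g, of m n] p by (auto dest: Lp_spaceD)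
        then have "(\<integral>\<^sup>+x. ennreal (\<bar>g m x - g n x\<bar> powr p) \<partial>M) = ennreal (pmass p M (\<lambda>x. g m x - g n x))"
          unfolding pmass_def by (intro nn_integral_eq_integral) auto
        then show ?case
          using cauchy[OF elim] by (simp add: ennreal_leI)
      qed
    qed auto
    finally show ?thesis .
  qed
  have int: "integrable M (\<lambda>x. \<bar>h x - g n x\<bar> powr p)" for n
    using bound[of n] by (intro integrableI_bounded) (auto simp: top_unique less_top[symmetric])
  have "(\<lambda>x. h x - g 0 x) \<in> Lp_space p M"
    using int by (auto simp: Lp_space_def)
  from Lp_space_add[OF this g[of 0]] have hL: "h \<in> Lp_space p M"
    using p by simp
  have "pmass p M (\<lambda>x. h x - g n x) \<le> ((1/2) ^ n) powr p" for n
    using bound[of n] nn_integral_eq_integral[OF int[of n]] by (simp add: pmass_def)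
  with hL show ?thesis by blast
qed

text \<open>
  The closure \<open>G\<close> of the graph of \<open>B\<close> is the graph of the extension: completeness gives it the
  whole space as domain, and boundedness makes it single-valued up to null sets. The values of
  the extension are picked from \<open>G\<close> by choice, so linearity holds almost everywhere only.
\<close>

lemma Lp_operator_extension:
  fixes M :: "'a measure" and S :: "('a \<Rightarrow> real) set"
  assumes fin: "finite_measure M" and p: "1 \<le> p"
    and S_Lp: "S \<subseteq> Lp_space p M"
    and S_lin: "\<And>f g a b. f \<in> S \<Longrightarrow> g \<in> S \<Longrightarrow> (\<lambda>x. a * f x + b * g x) \<in> S"
    and dense: "\<And>f e. f \<in> Lp_space p M \<Longrightarrow> 0 < e \<Longrightarrow> \<exists>q\<in>S. pmass p M (\<lambda>x. f x - q x) < e"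
    and B_Lp: "\<And>q. q \<in> S \<Longrightarrow> B q \<in> Lp_space p M"
    and B_lin: "\<And>f g a b. f \<in> S \<Longrightarrow> g \<in> S \<Longrightarrow> B (\<lambda>x. a * f x + b * g x) = (\<lambda>x. a * B f x + b * B g x)"
    and B_bound: "\<And>q. q \<in> S \<Longrightarrow> pmass p M (B q) \<le> pmass p M q"
  shows "\<exists>T. continuous_Lp_operator p M T \<and> (\<forall>q\<in>S. AE x in M. T q x = B q x)"
proof -
  have p0: "0 \<le> p" "0 < p" using p by auto
  let ?P = "pmass p M"
  define C where "C = 2 powr p * 2 powr p"
  have C: "C > 0" "2 powr p \<le> C"
    using p ge_one_powr_ge_zero[of 2 p] by (auto simp: C_def)
    define G where "G f h \<longleftrightarrow> h \<in> Lp_space p M \<and>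
      (\<forall>e>0. \<exists>q\<in>S. ?P (\<lambda>x. f x - q x) < e \<and> ?P (\<lambda>x. h x - B q x) < e)" for f h
  have B_diff: "?P (\<lambda>x. B f x - B g x) \<le> ?P (\<lambda>x. f x - g x)" if "f \<in> S" "g \<in> S" for f g
    using B_bound[OF S_lin[OF that, of 1 "-1"]] by (simp add: B_lin[OF that, of 1 "-1", simplified])
  have G_self: "G q (B q)" if "q \<in> S" for q
    unfolding G_def using that B_Lp by (auto intro!: bexI[of _ q] simp: pmass_zero)
  have G_ex: "\<exists>h. G f h" if f: "f \<in> Lp_space p M" for f
  proof -
    define d where "d n = ((1/2) ^ n) powr p / (2 * 2 powr p)" for n
    have d: "0 < d n" "d n + d m \<le> ((1/2) ^ n) powr p / 2 powr p" if "n \<le> m" for n m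
    proof -
      show "0 < d n" by (simp add: d_def)
      have "((1/2::real) ^ m) powr p \<le> ((1/2) ^ n) powr p"
        using that p by (intro powr_mono2 power_decreasing) auto
      then have "d m \<le> d n" by (simp add: d_def divide_right_mono)
      then show "d n + d m \<le> ((1/2) ^ n) powr p / 2 powr p"
        by (auto simp: d_def)
    qed
    have "\<exists>q\<in>S. ?P (\<lambda>x. f x - q x) < d n" for n
      using dense[OF f d(1)] by blast
    then obtain q where q: "\<And>n. q n \<in> S" "\<And>n. ?P (\<lambda>x. f x - q n x) < d n"
      by metis
    have qL: "q n \<in> Lp_space p M" for n using q(1) S_Lp by auto
    have "\<exists>h\<in>Lp_space p M. \<forall>n. ?P (\<lambda>x. h x - B (q n) x) \<le> ((1/2) ^ n) powr p"
    proof (rule Lp_complete[OF fin p])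
      show "B (q n) \<in> Lp_space p M" for n using B_Lp q(1) by auto
      fix n m :: nat assume nm: "n \<le> m"
      have "?P (\<lambda>x. B (q m) x - B (q n) x) \<le> ?P (\<lambda>x. q m x - q n x)"
        by (rule B_diff) (auto simp: q)
      also have "\<dots> = ?P (\<lambda>x. (q m x - f x) + (f x - q n x))" by simp
      also have "\<dots> \<le> 2 powr p * (?P (\<lambda>x. q m x - f x) + ?P (\<lambda>x. f x - q n x))"
        by (intro pmass_add_le Lp_space_diff qL f p0)
      also have "\<dots> = 2 powr p * (?P (\<lambda>x. f x - q m x) + ?P (\<lambda>x. f x - q n x))"
        by (simp add: pmass_diff_commute)
      also have "\<dots> \<le> 2 powr p * (((1/2) ^ n) powr p / 2 powr p)"
        using q(2)[of n] q(2)[of m] d(2)[OF nm] by (intro mult_left_mono) auto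
      finally show "?P (\<lambda>x. B (q m) x - B (q n) x) \<le> ((1/2) ^ n) powr p" by simp
    qed
    then obtain h where h: "h \<in> Lp_space p M"
        "\<And>n. ?P (\<lambda>x. h x - B (q n) x) \<le> ((1/2) ^ n) powr p" by blast
    have "\<exists>q\<in>S. ?P (\<lambda>x. f x - q x) < e \<and> ?P (\<lambda>x. h x - B q x) < e" if e: "0 < e" for e
    proof -
      have "(\<lambda>n. ((1/2::real) ^ n) powr p) \<longlonglongrightarrow> 0 powr p"
        using p by (intro tendsto_powr' LIMSEQ_realpow_zero tendsto_const) auto
      then have "\<forall>\<^sub>F n in sequentially. ((1/2::real) ^ n) powr p < e"
        using e by (intro order_tendstoD(2)) auto
      then obtain n where n: "((1/2::real) ^ n) powr p < e"
        by (auto simp: eventually_sequentially)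
      have "d n \<le> ((1/2) ^ n) powr p"
        using ge_one_powr_ge_zero[of 2 p] p by (auto simp: d_def field_simps intro!: mult_left_mono)
      then show ?thesis
        using n q(2)[of n] h(2)[of n] q(1)[of n] by (intro bexI[of _ "q n"]) auto
    qed
    then show ?thesis using h(1) unfolding G_def by blast
  qed
  have G_lin: "G (\<lambda>x. a * f x + b * g x) (\<lambda>x. a * h x + b * k x)"
    if f: "f \<in> Lp_space p M" and g: "g \<in> Lp_space p M" and fh: "G f h" and gk: "G g k" for f g h k a b
    unfolding G_def
  proof (intro conjI allI impI)
    show "(\<lambda>x. a * h x + b * k x) \<in> Lp_space p M"
      using fh gk by (intro Lp_space_lincomb p0) (auto simp: G_def)
    fix e :: real assume e: "0 < e"
    define D where "D = 2 powr p * (\<bar>a\<bar> powr p + \<bar>b\<bar> powr p) + 1"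
    have D: "D > 0" by (auto simp: D_def intro!: add_nonneg_pos)
    obtain q where q: "q \<in> S" "?P (\<lambda>x. f x - q x) < e / D" "?P (\<lambda>x. h x - B q x) < e / D"
      using fh e D unfolding G_def by (metis divide_pos_pos)
    obtain r where r: "r \<in> S" "?P (\<lambda>x. g x - r x) < e / D" "?P (\<lambda>x. k x - B r x) < e / D"
      using gk e D unfolding G_def by (metis divide_pos_pos)
    have est: "?P (\<lambda>x. a * f1 x + b * f2 x) < e"
      if "f1 \<in> Lp_space p M" "f2 \<in> Lp_space p M" "?P f1 < e / D" "?P f2 < e / D" for f1 f2
    proof -
      have "?P (\<lambda>x. a * f1 x + b * f2 x) \<le> 2 powr p * (\<bar>a\<bar> powr p * ?P f1 + \<bar>b\<bar> powr p * ?P f2)"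
        using that by (intro pmass_lincomb_le p0)
      also have "\<dots> \<le> 2 powr p * (\<bar>a\<bar> powr p * (e / D) + \<bar>b\<bar> powr p * (e / D))"
        using that by (intro mult_left_mono add_mono) auto
      also have "\<dots> = (2 powr p * (\<bar>a\<bar> powr p + \<bar>b\<bar> powr p)) * (e / D)"
        by (simp only: distrib_left distrib_right mult.assoc)
      also have "\<dots> = (D - 1) * (e / D)"
        by (simp add: D_def)
      also have "\<dots> < e"
        using e D by (simp add: field_simps)
      finally show ?thesis .
    qed
    have L: "h \<in> Lp_space p M" "k \<in> Lp_space p M" "q \<in> Lp_space p M" "r \<in> Lp_space p M"
      using fh gk q r S_Lp by (auto simp: G_def)
    show "\<exists>s\<in>S. ?P (\<lambda>x. a * f x + b * g x - s x) < e \<and> ?P (\<lambda>x. a * h x + b * k x - B s x) < e"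
    proof (intro bexI conjI)
      show "(\<lambda>x. a * q x + b * r x) \<in> S" using S_lin q r by auto
      have "(\<lambda>x. a * f x + b * g x - (a * q x + b * r x)) = (\<lambda>x. a * (f x - q x) + b * (g x - r x))"
        by (auto simp: algebra_simps)
      then show "?P (\<lambda>x. a * f x + b * g x - (a * q x + b * r x)) < e"
        using est[of "\<lambda>x. f x - q x" "\<lambda>x. g x - r x"] f g q r L p0 by (simp add: Lp_space_diff)
      have "(\<lambda>x. a * h x + b * k x - B (\<lambda>x. a * q x + b * r x) x)
          = (\<lambda>x. a * (h x - B q x) + b * (k x - B r x))"
        by (auto simp: B_lin[OF q(1) r(1)] algebra_simps)
      then show "?P (\<lambda>x. a * h x + b * k x - B (\<lambda>x. a * q x + b * r x) x) < e"
        using est[of "\<lambda>x. h x - B q x" "\<lambda>x. k x - B r x"] q r L p0 B_Lp by (simp add: Lp_space_diff)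
    qed
  qed
  have G_bound: "?P h \<le> C * ?P f" if f: "f \<in> Lp_space p M" and fh: "G f h" for f h
  proof (rule field_le_epsilon)
    fix e :: real assume e: "0 < e"
    define d where "d = e / (C + C)"
    have d: "0 < d" using e C by (simp add: d_def)
    obtain q where q: "q \<in> S" "?P (\<lambda>x. f x - q x) < d" "?P (\<lambda>x. h x - B q x) < d"
      using fh d unfolding G_def by blast
    have L: "h \<in> Lp_space p M" "q \<in> Lp_space p M" "B q \<in> Lp_space p M"
      using fh q S_Lp B_Lp by (auto simp: G_def)
    have "?P q = ?P (\<lambda>x. (q x - f x) + f x)" by simp
    also have "\<dots> \<le> 2 powr p * (?P (\<lambda>x. q x - f x) + ?P f)"
      by (intro pmass_add_le Lp_space_diff L p0 f)
    also have "\<dots> \<le> 2 powr p * (d + ?P f)"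
      using q(2) by (intro mult_left_mono add_right_mono) (auto simp: pmass_diff_commute[of p M q f])
    finally have Bq: "?P (B q) \<le> 2 powr p * (d + ?P f)"
      using B_bound[OF q(1)] by linarith
    have "?P h = ?P (\<lambda>x. (h x - B q x) + B q x)" by simp
    also have "\<dots> \<le> 2 powr p * (?P (\<lambda>x. h x - B q x) + ?P (B q))"
      by (intro pmass_add_le Lp_space_diff L p0)
    also have "\<dots> \<le> 2 powr p * (d + 2 powr p * (d + ?P f))"
      using q(3) Bq by (intro mult_left_mono add_mono) auto
    also have "\<dots> = 2 powr p * d + C * (d + ?P f)"
      by (simp add: C_def algebra_simps)
    also have "\<dots> \<le> C * d + C * (d + ?P f)"
      using C d by (intro add_right_mono mult_right_mono) auto
    also have "\<dots> = C * ?P f + e"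
      using C e by (simp add: d_def field_simps)
    finally show "?P h \<le> C * ?P f + e" .
  qed
  have G_unique: "AE x in M. h x = k x"
    if f: "f \<in> Lp_space p M" and "G f h" "G f k" for f h k
  proof -
    have L: "(\<lambda>x. h x - k x) \<in> Lp_space p M"
      using that p0 by (auto simp: G_def intro: Lp_space_diff)
    have "?P (\<lambda>x. h x - k x) \<le> C * ?P (\<lambda>x. f x - f x)"
      using G_lin[OF f f that(2,3), of 1 "-1"] Lp_space_diff[OF f f p0(1)] G_bound by fastforce
    then have "AE x in M. h x - k x = 0"
      using L by (intro pmass_eq_0_imp_AE) (auto simp: pmass_zero)
    then show ?thesis by auto
  qed
  define T where "T f = (SOME h. G f h)" for f
  have T: "G f (T f)" if "f \<in> Lp_space p M" for f
    unfolding T_def using G_ex[OF that] by (rule someI_ex)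
  have T_Lp: "T f \<in> Lp_space p M" if "f \<in> Lp_space p M" for f
    using T[OF that] by (auto simp: G_def)
  have "continuous_Lp_operator p M T"
    unfolding continuous_Lp_operator_def
  proof (intro conjI ballI allI impI)
    fix f g :: "'a \<Rightarrow> real" and a b :: real
    assume f: "f \<in> Lp_space p M" and g: "g \<in> Lp_space p M"
    have L: "(\<lambda>y. a * f y + b * g y) \<in> Lp_space p M"
      using f g p0 by (intro Lp_space_lincomb)
    show "AE x in M. T (\<lambda>y. a * f y + b * g y) x = a * T f x + b * T g x"
      by (rule G_unique[OF L T[OF L] G_lin[OF f g T[OF f] T[OF g]]])
  next
    fix f :: "'a \<Rightarrow> real" and e :: real
    assume f: "f \<in> Lp_space p M" and e: "0 < e"
    define d where "d = (e powr p / C) powr (1 / p)"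
    have d: "d > 0" "C * d powr p = e powr p"
      using e C p by (auto simp: d_def powr_powr)
    show "\<exists>d>0. \<forall>g\<in>Lp_space p M. Lp_norm p M (\<lambda>x. g x - f x) < d \<longrightarrow>
             Lp_norm p M (\<lambda>x. T g x - T f x) < e"
    proof (intro exI[of _ d] conjI ballI impI d)
      fix g assume g: "g \<in> Lp_space p M" and "Lp_norm p M (\<lambda>x. g x - f x) < d"
      then have small: "?P (\<lambda>x. g x - f x) < d powr p"
        using Lp_norm_less_iff[OF p0(2) d(1)] by auto
      have "?P (\<lambda>x. T g x - T f x) \<le> C * ?P (\<lambda>x. g x - f x)"
        using G_bound[OF Lp_space_diff[OF g f p0(1)]] G_lin[OF g f T[OF g] T[OF f], of 1 "-1"] by simp
      also have "\<dots> < e powr p"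
        using small C d(2) by (metis mult_strict_left_mono)
      finally show "Lp_norm p M (\<lambda>x. T g x - T f x) < e"
        using Lp_norm_less_iff[OF p0(2) e] by auto
    qed
  qed (rule T_Lp)
  moreover have "AE x in M. T q x = B q x" if "q \<in> S" for q
    using G_unique[OF _ T G_self[OF that]] that S_Lp by auto
  ultimately show ?thesis by blast
qed

section \<open>Density of polynomials\<close>

text \<open>
  Three approximations: by a truncation (dominated convergence), by a continuous function
  (measurable functions are almost everywhere limits of continuous ones), and by a polynomial
  (Stone--Weierstrass on a compact set of full measure).
\<close>

lemma polynomials_dense_Lp:
  fixes M :: "'a::euclidean_space measure" and f :: "'a \<Rightarrow> real"
  assumes fin: "finite_measure M" and sets: "sets M = sets borel"
    and ac: "absolutely_continuous lborel M"
    and S: "compact S" "AE x in M. x \<in> S"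
    and p: "0 < p" and f: "f \<in> Lp_space p M" and eps: "0 < \<epsilon>"
  shows "\<exists>q. real_polynomial_function q \<and> pmass p M (\<lambda>x. f x - q x) < \<epsilon>"
proof -
  interpret finite_measure M by (rule fin)
  note [measurable_cong] = sets
  define \<delta> where "\<delta> = \<epsilon> / (4 * (2 powr p * 2 powr p))"
  have \<delta>: "0 < \<delta>" using eps by (simp add: \<delta>_def)
  have [measurable]: "f \<in> borel_measurable borel"
    using Lp_spaceD(1)[OF f] by (simp cong: measurable_cong_sets)
  define clip where "clip n t = max (- real n) (min (real n) t)" for n :: nat and t :: real
  have clip_bound: "\<bar>clip n t\<bar> \<le> real n" for n t by (auto simp: clip_def)
  have clip_cont: "continuous_on UNIV (\<lambda>t. clip n t)" for n
    unfolding clip_def by (intro continuous_intros)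
  have [measurable]: "clip n \<in> borel_measurable borel" for n
    using clip_cont by (rule borel_measurable_continuous_onI)
  have bounded_Lp: "g \<in> Lp_space p M"
    if [measurable]: "g \<in> borel_measurable borel" and B: "AE x in M. \<bar>g x\<bar> \<le> B" for g and B :: real
  proof -
    have "AE x in M. norm (\<bar>g x\<bar> powr p) \<le> B powr p"
      using B by eventually_elim (use p in \<open>auto intro!: powr_mono2\<close>)
    moreover have m: "g \<in> borel_measurable M" by measurable
    ultimately have "integrable M (\<lambda>x. \<bar>g x\<bar> powr p)"
      by (intro integrable_const_bound[of _ "B powr p"]) auto
    with m show ?thesis by (simp add: Lp_space_def)
  qed
  \<comment> \<open>Truncation: the error is dominated by \<open>\<bar>f\<bar>\<close> and vanishes from some \<open>n\<close> on at each point.\<close>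
  have "(\<lambda>n. pmass p M (\<lambda>x. f x - clip n (f x))) \<longlonglongrightarrow> (\<integral>x. 0 \<partial>M)"
    unfolding pmass_def
  proof (rule integral_dominated_convergence)
    show "integrable M (\<lambda>x. \<bar>f x\<bar> powr p)" using f by (rule Lp_spaceD)
    show "AE x in M. norm (\<bar>f x - clip n (f x)\<bar> powr p) \<le> \<bar>f x\<bar> powr p" for n
      using p by (auto simp: clip_def intro!: AE_I2 powr_mono2)
    show "AE x in M. (\<lambda>n. \<bar>f x - clip n (f x)\<bar> powr p) \<longlonglongrightarrow> 0"
    proof (intro AE_I2 tendsto_eventually)
      fix x
      obtain m :: nat where m: "\<bar>f x\<bar> \<le> real m" using real_arch_simple by blast
      show "\<forall>\<^sub>F n in sequentially. \<bar>f x - clip n (f x)\<bar> powr p = 0"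
        using eventually_ge_at_top[of m] by eventually_elim (use m in \<open>auto simp: clip_def\<close>)
    qed
  qed auto
  then have "\<forall>\<^sub>F n in sequentially. pmass p M (\<lambda>x. f x - clip n (f x)) < \<delta>"
    using \<delta> by (intro order_tendstoD(2)) auto
  then obtain n where n: "pmass p M (\<lambda>x. f x - clip n (f x)) < \<delta>"
    by (auto simp: eventually_sequentially)
  define g where "g x = clip n (f x)" for x
  have [measurable]: "g \<in> borel_measurable borel" unfolding g_def by measurable
  \<comment> \<open>The approximating continuous functions are truncated as well, to make them uniformly bounded.\<close>
  have "g \<in> borel_measurable (lebesgue_on UNIV)"
    by (simp add: lebesgue_on_UNIV_eq measurable_completion)
  then have "g measurable_on UNIV"
    by (subst measurable_on_iff_borel_measurable) auto
  then obtain N h where N: "negligible N" and h: "\<And>k. continuous_on UNIV (h k)"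
      "\<And>x. x \<notin> N \<Longrightarrow> (\<lambda>k. h k x) \<longlonglongrightarrow> g x"
    unfolding measurable_on_def by auto
  have h_meas [measurable]: "h k \<in> borel_measurable borel" for k
    using h(1) by (rule borel_measurable_continuous_onI)
  have "AE x in lebesgue. x \<notin> N"
    using N by (intro AE_not_in) (simp add: negligible_iff_null_sets)
  then have "AE x in lborel. x \<notin> N"
    by (simp add: AE_completion_iff)
  then have AE_N: "AE x in M. x \<notin> N"
    by (rule absolutely_continuous_AE[OF sets[unfolded sets_lborel[symmetric]] ac])
  have "(\<lambda>k. pmass p M (\<lambda>x. g x - clip n (h k x))) \<longlonglongrightarrow> (\<integral>x. 0 \<partial>M)"
    unfolding pmass_def
  proof (rule integral_dominated_convergence)
    show "integrable M (\<lambda>x. (2 * real n) powr p)" by simp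
    show "AE x in M. norm (\<bar>g x - clip n (h k x)\<bar> powr p) \<le> (2 * real n) powr p" for k
    proof (intro AE_I2)
      fix x
      have "\<bar>g x - clip n (h k x)\<bar> \<le> 2 * real n"
        using clip_bound[of n "f x"] clip_bound[of n "h k x"] unfolding g_def by linarith
      then show "norm (\<bar>g x - clip n (h k x)\<bar> powr p) \<le> (2 * real n) powr p"
        using p by (auto intro!: powr_mono2)
    qed
    show "AE x in M. (\<lambda>k. \<bar>g x - clip n (h k x)\<bar> powr p) \<longlonglongrightarrow> 0"
      using AE_N
    proof eventually_elim
      case (elim x)
      have "(\<lambda>k. clip n (h k x)) \<longlonglongrightarrow> clip n (g x)"
        unfolding clip_def by (intro tendsto_intros h elim)
      then have "(\<lambda>k. \<bar>g x - clip n (h k x)\<bar> powr p) \<longlonglongrightarrow> \<bar>g x - clip n (g x)\<bar> powr p"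
        using p by (intro tendsto_powr' tendsto_intros) auto
      then show ?case by (simp add: g_def clip_def)
    qed
  qed auto
  then have "\<forall>\<^sub>F k in sequentially. pmass p M (\<lambda>x. g x - clip n (h k x)) < \<delta>"
    using \<delta> by (intro order_tendstoD(2)) auto
  then obtain k where k: "pmass p M (\<lambda>x. g x - clip n (h k x)) < \<delta>"
    by (auto simp: eventually_sequentially)
  define u where "u x = clip n (h k x)" for x
  have u_cont: "continuous_on UNIV u"
    unfolding u_def by (rule continuous_on_compose2[OF clip_cont h(1)]) auto
  \<comment> \<open>A uniform error \<open>\<eta>\<close> on \<open>S\<close> costs \<open>\<eta>\<^sup>p\<close> times the total mass; the \<open>1\<close> in \<open>c\<close> covers total mass \<open>0\<close>.\<close>
  define c where "c = measure M (space M) + 1"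
  have c: "0 < c" by (simp add: c_def add_nonneg_pos)
  define \<eta> where "\<eta> = (\<delta> / c) powr (1 / p)"
  have \<eta>: "0 < \<eta>" "\<eta> powr p = \<delta> / c"
    using \<delta> c p by (auto simp: \<eta>_def powr_powr)
  obtain q where q: "real_polynomial_function q" "\<And>x. x \<in> S \<Longrightarrow> \<bar>u x - q x\<bar> < \<eta>"
    using Stone_Weierstrass_real_polynomial_function[OF S(1) continuous_on_subset[OF u_cont subset_UNIV] \<eta>(1)] by blast
  have q_cont: "continuous_on UNIV q"
    using q(1) by (simp add: continuous_on_polymonial_function real_polynomial_function_eq)
  have [measurable]: "u \<in> borel_measurable borel" "q \<in> borel_measurable borel"
    using u_cont q_cont by (auto intro: borel_measurable_continuous_onI)
  have close: "AE x in M. \<bar>u x - q x\<bar> \<le> \<eta>"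
    using S(2) by eventually_elim (use q(2) in force)
  have L: "(\<lambda>x. f x - g x) \<in> Lp_space p M" "(\<lambda>x. g x - u x) \<in> Lp_space p M" "(\<lambda>x. u x - q x) \<in> Lp_space p M"
  proof -
    have gL: "g \<in> Lp_space p M"
      by (rule bounded_Lp[of _ "real n"]) (auto simp: g_def clip_bound)
    have uL: "u \<in> Lp_space p M"
      by (rule bounded_Lp[of _ "real n"]) (auto simp: u_def clip_bound)
    show "(\<lambda>x. f x - g x) \<in> Lp_space p M" "(\<lambda>x. g x - u x) \<in> Lp_space p M"
      using p by (auto intro!: Lp_space_diff f gL uL)
    show "(\<lambda>x. u x - q x) \<in> Lp_space p M"
      by (rule bounded_Lp[OF _ close]) measurable
  qed
  have "pmass p M (\<lambda>x. u x - q x) \<le> (\<integral>x. \<eta> powr p \<partial>M)"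
    unfolding pmass_def
  proof (rule integral_mono_AE)
    show "integrable M (\<lambda>x. \<bar>u x - q x\<bar> powr p)" using L(3) by (rule Lp_spaceD)
    show "AE x in M. \<bar>u x - q x\<bar> powr p \<le> \<eta> powr p"
      using close by eventually_elim (use p in \<open>auto intro!: powr_mono2\<close>)
  qed simp
  also have "\<dots> = measure M (space M) * (\<delta> / c)"
    by (simp add: \<eta>)
  also have "\<dots> < c * (\<delta> / c)"
    using \<delta> c by (intro mult_strict_right_mono) (auto simp: c_def)
  finally have uq: "pmass p M (\<lambda>x. u x - q x) < \<delta>" using c by simp
  have gu: "pmass p M (\<lambda>x. g x - u x) < \<delta>" using k by (simp add: u_def)
  have fg: "pmass p M (\<lambda>x. f x - g x) < \<delta>" using n by (simp add: g_def)
  have one: "1 \<le> (2::real) powr p" using p by (intro ge_one_powr_ge_zero) auto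
  have "pmass p M (\<lambda>x. g x - q x) = pmass p M (\<lambda>x. (g x - u x) + (u x - q x))" by simp
  also have "\<dots> \<le> 2 powr p * (pmass p M (\<lambda>x. g x - u x) + pmass p M (\<lambda>x. u x - q x))"
    using p by (intro pmass_add_le L) auto
  also have "\<dots> \<le> 2 powr p * (\<delta> + \<delta>)"
    using gu uq by (intro mult_left_mono add_mono) auto
  finally have gq: "pmass p M (\<lambda>x. g x - q x) \<le> 2 powr p * (\<delta> + \<delta>)" .
  have "pmass p M (\<lambda>x. f x - q x) = pmass p M (\<lambda>x. (f x - g x) + (g x - q x))" by simp
  also have "\<dots> \<le> 2 powr p * (pmass p M (\<lambda>x. f x - g x) + pmass p M (\<lambda>x. g x - q x))"
    using p Lp_space_add[OF L(2,3)] by (intro pmass_add_le L) auto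
  also have "\<dots> \<le> 2 powr p * (2 powr p * \<delta> + 2 powr p * (\<delta> + \<delta>))"
  proof (intro mult_left_mono add_mono gq)
    show "pmass p M (\<lambda>x. f x - g x) \<le> 2 powr p * \<delta>"
      using fg mult_right_mono[OF one, of \<delta>] \<delta> by linarith
  qed simp
  also have "\<dots> = 3 / 4 * \<epsilon>"
    by (simp add: \<delta>_def field_simps)
  also have "\<dots> < \<epsilon>" using eps by simp
  finally show ?thesis using q(1) by blast
qed

section \<open>Increasing enumeration of discrete sets of reals\<close>

lemma strict_mono_enumeration_unique:
  fixes r s :: "nat \<Rightarrow> 'a::linorder"
  assumes "strict_mono r" "strict_mono s" "range r = range s"
  shows "r = s"
proof
  have le: "r n \<le> s n"
    if r: "strict_mono r" and s: "strict_mono s" and eq: "range r = range s"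
      and IH: "\<And>m. m < n \<Longrightarrow> r m = s m" for r s :: "nat \<Rightarrow> 'a" and n
  proof -
    have "s n \<in> range r" using eq by auto
    then obtain m where m: "s n = r m" by auto
    have "\<not> m < n"
    proof
      assume "m < n"
      then have "s n = s m" using IH m by auto
      then show False using strict_mono_less[OF s] \<open>m < n\<close> by (metis less_irrefl)
    qed
    then show ?thesis using strict_mono_less_eq[OF r, of n m] m by auto
  qed
  fix n show "r n = s n"
  proof (induction n rule: less_induct)
    case (less n)
    then show ?case
      using le[OF assms, of n] le[OF assms(2,1) assms(3)[symmetric], of n] by (auto intro: antisym)
  qed
qed

text \<open>
  Every nonempty part of \<open>E\<close> has a least element. The enumeration starts at the least element of
  \<open>E\<close> and proceeds to the least element above the current one; a point that it missed would have
  infinitely many points of \<open>E\<close> below it.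
\<close>

lemma strict_mono_enumeration_exists:
  fixes E :: "real set"
  assumes inf: "infinite E" and fin: "\<And>B. finite {x \<in> E. x \<le> B}"
  shows "\<exists>r::nat \<Rightarrow> real. strict_mono r \<and> range r = E"
proof -
  have least: "\<exists>m\<in>A. \<forall>y\<in>A. m \<le> y" if "A \<subseteq> E" "A \<noteq> {}" for A
  proof -
    obtain a where a: "a \<in> A" using \<open>A \<noteq> {}\<close> by auto
    have f: "finite {x \<in> A. x \<le> a}" by (rule finite_subset[OF _ fin[of a]]) (use \<open>A \<subseteq> E\<close> in auto)
    have ne: "{x \<in> A. x \<le> a} \<noteq> {}" using a by auto
    have "Min {x \<in> A. x \<le> a} \<in> A" using Min_in[OF f ne] by auto
    moreover have "Min {x \<in> A. x \<le> a} \<le> y" if "y \<in> A" for y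
    proof (cases "y \<le> a")
      case True
      then show ?thesis using that f by auto
    next
      case False
      then show ?thesis using Min_in[OF f ne] by auto
    qed
    ultimately show ?thesis by blast
  qed
  have "\<exists>r. \<forall>n. (r n \<in> E \<and> (n = 0 \<longrightarrow> (\<forall>y\<in>E. r n \<le> y))) \<and>
      (r n < r (Suc n) \<and> (\<forall>z\<in>E. r n < z \<longrightarrow> r (Suc n) \<le> z))"
  proof (rule dependent_nat_choice)
    show "\<exists>x. x \<in> E \<and> (0 = 0 \<longrightarrow> (\<forall>y\<in>E. x \<le> y))"
      using least[of E] inf by auto
    fix x and n :: nat assume "x \<in> E \<and> (n = 0 \<longrightarrow> (\<forall>y\<in>E. x \<le> y))"
    have "{z \<in> E. x < z} \<noteq> {}"
    proof
      assume "{z \<in> E. x < z} = {}"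
      then have "E = {z \<in> E. z \<le> x}" by force
      then show False using inf fin[of x] by simp
    qed
    then show "\<exists>y. (y \<in> E \<and> (Suc n = 0 \<longrightarrow> (\<forall>z\<in>E. y \<le> z))) \<and> x < y \<and> (\<forall>z\<in>E. x < z \<longrightarrow> y \<le> z)"
      using least[of "{z \<in> E. x < z}"] by auto
  qed
  then obtain r where r: "\<And>n. r n \<in> E" "\<And>y. y \<in> E \<Longrightarrow> r 0 \<le> y"
      "\<And>n. r n < r (Suc n)" "\<And>n z. z \<in> E \<Longrightarrow> r n < z \<Longrightarrow> r (Suc n) \<le> z"
    by metis
  have mono: "strict_mono r" using r(3) by (simp add: strict_mono_Suc_iff)
  moreover have "z \<in> range r" if z: "z \<in> E" for z
  proof (rule ccontr)
    assume nz: "z \<notin> range r"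
    have "r n < z" for n
    proof (induction n)
      case 0
      show ?case using r(2)[OF z] nz by (metis order_le_less rangeI)
    next
      case (Suc n)
      show ?case using r(4)[OF z Suc] nz by (metis order_le_less rangeI)
    qed
    then have "range r \<subseteq> {x \<in> E. x \<le> z}" using r(1) by (auto intro: less_imp_le)
    then have "finite (range r)" using fin finite_subset by blast
    then show False using strict_mono_imp_inj_on[OF mono] finite_imageD infinite_UNIV_nat by blast
  qed
  ultimately show ?thesis using r(1) by blast
qed

section \<open>The Jacobi operator on polynomials in one variable\<close>

text \<open>
  With the weight \<open>w a b = (1 - x) powr a * (1 + x) powr b\<close> this is
  \<open>r \<mapsto> (w (a + 1) (b + 1) * r)' / w a b\<close> (see \<open>jacobi_raise_deriv\<close>): up to sign the adjoint of
  differentiation, mapping from the parameters \<open>(a + 1, b + 1)\<close> to \<open>(a, b)\<close>. Composed with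
  differentiation it gives the Jacobi operator.
\<close>

definition jacobi_raise :: "real \<Rightarrow> real \<Rightarrow> real poly \<Rightarrow> real poly" where
  "jacobi_raise a b r = [:1, 0, -1:] * pderiv r + [:b - a, - (a + b + 2):] * r"

definition jacobi_operator :: "real \<Rightarrow> real \<Rightarrow> real poly \<Rightarrow> real poly" where
  "jacobi_operator a b q = jacobi_raise a b (pderiv q)"

lemma jacobi_raise_smult: "jacobi_raise a b (smult c r) = smult c (jacobi_raise a b r)"
  by (simp add: jacobi_raise_def pderiv_smult smult_add_right)

lemma jacobi_raise_add: "jacobi_raise a b (r + s) = jacobi_raise a b r + jacobi_raise a b s"
  by (rule poly_ext) (simp add: jacobi_raise_def pderiv_add algebra_simps)

lemma jacobi_operator_smult: "jacobi_operator a b (smult c r) = smult c (jacobi_operator a b r)"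
  by (simp add: jacobi_operator_def pderiv_smult jacobi_raise_smult)

lemma jacobi_operator_sum:
  "jacobi_operator a b (\<Sum>k\<in>K. f k) = (\<Sum>k\<in>K. jacobi_operator a b (f k))"
proof -
  have "jacobi_operator a b 0 = 0"
    by (simp add: jacobi_operator_def jacobi_raise_def)
  then show ?thesis
    by (induction K rule: infinite_finite_induct)
       (auto simp: jacobi_operator_def pderiv_add jacobi_raise_add)
qed

text \<open>
  Write \<open>D\<close> for differentiation and \<open>D\<^sup>*\<close> for the raising operator. Then the Jacobi operator is
  \<open>D\<^sup>* D\<close>, and \<open>D D\<^sup>*\<close> is the Jacobi operator with shifted parameters up to a constant, so
  \<open>(D\<^sup>* D) D\<^sup>* = D\<^sup>* (D D\<^sup>*)\<close> shows that \<open>D\<^sup>*\<close> maps eigenfunctions to eigenfunctions.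
\<close>

lemma jacobi_operator_raise:
  "jacobi_operator a b (jacobi_raise a b r)
    = jacobi_raise a b (jacobi_operator (a + 1) (b + 1) r - smult (a + b + 2) r)"
proof -
  have "pderiv (jacobi_raise a b r) = jacobi_operator (a + 1) (b + 1) r - smult (a + b + 2) r"
    by (rule poly_ext) (simp add: jacobi_raise_def jacobi_operator_def pderiv_add pderiv_mult
        pderiv_pCons pderiv_minus pderiv_diff pderiv_smult algebra_simps)
  then show ?thesis by (simp add: jacobi_operator_def)
qed

lemma jacobi_raise_deriv:
  assumes "t \<in> {-1<..<1}"
  shows "((\<lambda>t. (1 - t) powr (a + 1) * (1 + t) powr (b + 1) * poly r t) has_real_derivative
      (1 - t) powr a * (1 + t) powr b * poly (jacobi_raise a b r) t) (at t)"
proof -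
  have p: "(1 - t) powr (a + 1) = (1 - t) powr a * (1 - t)" "(1 + t) powr (b + 1) = (1 + t) powr b * (1 + t)"
    "(1 - t) powr (1 + a) = (1 - t) powr a * (1 - t)" "(1 + t) powr (1 + b) = (1 + t) powr b * (1 + t)"
    using assms by (auto simp: powr_add)
  show ?thesis
    by (rule derivative_eq_intros | use assms in force)+
      (simp add: p jacobi_raise_def algebra_simps)
qed

text \<open>
  The polynomial factor in the \<open>n\<close>-th derivative in Rodrigues' formula. One differentiation is one
  raising step, and it lowers both exponents by one; hence the shifted parameters.
\<close>

primrec rodrigues :: "nat \<Rightarrow> real \<Rightarrow> real \<Rightarrow> real poly" where
  "rodrigues 0 a b = 1"
| "rodrigues (Suc n) a b = jacobi_raise a b (rodrigues n (a + 1) (b + 1))"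

lemma rodrigues_formula:
  assumes "t \<in> {-1<..<1}"
  shows "(deriv ^^ n) (\<lambda>t. (1 - t) powr (a + real n) * (1 + t) powr (b + real n)) t
       = (1 - t) powr a * (1 + t) powr b * poly (rodrigues n a b) t"
  using assms
proof (induction n arbitrary: a b t)
  case (Suc n)
  have "(deriv ^^ Suc n) (\<lambda>t. (1 - t) powr (a + real (Suc n)) * (1 + t) powr (b + real (Suc n))) t
      = deriv ((deriv ^^ n) (\<lambda>t. (1 - t) powr ((a + 1) + real n) * (1 + t) powr ((b + 1) + real n))) t"
    by (simp add: algebra_simps)
  also have "\<dots> = deriv (\<lambda>t. (1 - t) powr (a + 1) * (1 + t) powr (b + 1) * poly (rodrigues n (a + 1) (b + 1)) t) t"
  proof (rule deriv_cong_ev)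
    show "\<forall>\<^sub>F t in nhds t. (deriv ^^ n) (\<lambda>t. (1 - t) powr ((a + 1) + real n) * (1 + t) powr ((b + 1) + real n)) t
      = (1 - t) powr (a + 1) * (1 + t) powr (b + 1) * poly (rodrigues n (a + 1) (b + 1)) t"
      using eventually_nhds_in_open[of "{-1<..<1}" t] Suc.prems
      by (auto elim!: eventually_mono simp: Suc.IH)
  qed simp
  also have "\<dots> = (1 - t) powr a * (1 + t) powr b * poly (rodrigues (Suc n) a b) t"
    using jacobi_raise_deriv[OF Suc.prems] by (auto intro: DERIV_imp_deriv)
  finally show ?case .
qed simp

text \<open>
  Each raising step adds \<open>a + b + 2\<close> to the eigenvalue, and
  \<open>n (n + a + b + 3) + a + b + 2 = (n + 1) (n + a + b + 2)\<close>.
\<close>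

lemma rodrigues_eigen:
  "jacobi_operator a b (rodrigues n a b) = smult (- (real n * (real n + a + b + 1))) (rodrigues n a b)"
proof (induction n arbitrary: a b)
  case 0
  then show ?case by (simp add: jacobi_operator_def jacobi_raise_def pderiv_1)
next
  case (Suc n)
  have "jacobi_operator a b (rodrigues (Suc n) a b)
      = jacobi_raise a b (smult (- (real n * (real n + (a + 1) + (b + 1) + 1)) - (a + b + 2)) (rodrigues n (a + 1) (b + 1)))"
    by (simp add: jacobi_operator_raise Suc.IH smult_diff_left)
  also have "- (real n * (real n + (a + 1) + (b + 1) + 1)) - (a + b + 2) = - (real (Suc n) * (real (Suc n) + a + b + 1))"
    by (simp add: algebra_simps)
  finally show ?case
    by (simp only: jacobi_raise_smult rodrigues.simps)
qed

lemma coeff_jacobi_raise: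
  "coeff (jacobi_raise a b r) (Suc k)
    = real (Suc (Suc k)) * coeff r (Suc (Suc k)) - (real k + a + b + 2) * coeff r k + (b - a) * coeff r (Suc k)"
  by (cases k) (simp_all add: jacobi_raise_def coeff_pderiv algebra_simps)

text \<open>
  A raising step multiplies the leading coefficient by \<open>- (n + a + b + 2)\<close>, which is nonzero under
  the assumption on \<open>a + b\<close>.
\<close>

lemma rodrigues_degree:
  assumes "a + b > -1"
  shows "degree (rodrigues n a b) = n" "rodrigues n a b \<noteq> 0"
proof -
  have "degree (rodrigues n a b) \<le> n \<and> coeff (rodrigues n a b) n \<noteq> 0"
    using assms
  proof (induction n arbitrary: a b)
    case (Suc n)
    let ?r = "rodrigues n (a + 1) (b + 1)"
    have r: "degree ?r \<le> n" "coeff ?r n \<noteq> 0"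
      using Suc.IH[of "a + 1" "b + 1"] Suc.prems by auto
    have "degree (rodrigues (Suc n) a b) \<le> Suc n"
    proof (rule degree_le, intro allI impI)
      fix i assume "i > Suc n"
      then obtain k where "i = Suc k" "k > n" by (cases i) auto
      then show "coeff (rodrigues (Suc n) a b) i = 0"
        using r(1) by (simp add: coeff_jacobi_raise coeff_eq_0)
    qed
    moreover have "coeff (rodrigues (Suc n) a b) (Suc n) = - (real n + a + b + 2) * coeff ?r n"
      using r(1) by (simp add: coeff_jacobi_raise coeff_eq_0 algebra_simps)
    ultimately show ?case
      using r(2) Suc.prems by auto
  qed simp
  then show "degree (rodrigues n a b) = n" "rodrigues n a b \<noteq> 0"
    by (auto intro: antisym le_degree)
qed

section \<open>Orthonormality of the Jacobi polynomials\<close>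

lemma jacobi_density_nonneg:
  assumes "a > -1" "b > -1"
  shows "0 \<le> jacobi_density a b x"
  using assms by (auto simp: jacobi_density_def Beta_def intro!: divide_nonneg_nonneg mult_nonneg_nonneg Gamma_real_nonneg)

definition jacobi_normalization :: "real \<Rightarrow> real \<Rightarrow> real" where
  "jacobi_normalization a b = 2 powr (a + b + 1) * Beta (a + 1) (b + 1)"

lemma jacobi_normalization_pos: "a > -1 \<Longrightarrow> b > -1 \<Longrightarrow> jacobi_normalization a b > 0"
  by (auto simp: jacobi_normalization_def Beta_def intro!: mult_pos_pos divide_pos_pos Gamma_real_pos)

lemma jacobi_density_measurable [measurable]: "jacobi_density a b \<in> borel_measurable borel"
  unfolding jacobi_density_def by measurable

text \<open>
  The substitution \<open>t \<mapsto> (t + 1) / 2\<close> turns the weight into the integrand of the Beta integral.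
\<close>

lemma jacobi_density_integrable:
  assumes "a > -1" "b > -1"
  shows "integrable lborel (jacobi_density a b)"
proof -
  have "((\<lambda>t. t powr (b + 1 - 1) * (1 - t) powr (a + 1 - 1)) has_integral Beta (b + 1) (a + 1)) {0..1}"
    using assms by (intro has_integral_Beta_real) auto
  then have "((\<lambda>t. t powr b * (1 - t) powr a) has_integral Beta (b + 1) (a + 1)) (cbox 0 1)"
    by simp
  from has_integral_affinity[OF this, of "1/2" "1/2"]
  have "(\<lambda>t. (t / 2 + 1 / 2) powr b * (1 - (t / 2 + 1 / 2)) powr a) integrable_on ((\<lambda>x. 2 * x - 1) ` {0..1})"
    by (auto simp: integrable_on_def)
  also have "(\<lambda>x. 2 * x - 1) ` {0..1} = {-1..1::real}"
    by (simp add: image_affinity_atLeastAtMost_diff)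
  finally have "(\<lambda>t. (t / 2 + 1 / 2) powr b * (1 - (t / 2 + 1 / 2)) powr a) integrable_on {-1..1}" .
  from integrable_cmul[OF this, of "2 powr (a + b) / jacobi_normalization a b"]
  have "(\<lambda>t. 2 powr (a + b) / jacobi_normalization a b * ((t / 2 + 1 / 2) powr b * (1 - (t / 2 + 1 / 2)) powr a)) integrable_on {-1..1}"
    by (simp only: real_scaleR_def)
  also have "?this \<longleftrightarrow> jacobi_density a b integrable_on {-1..1}"
  proof (rule integrable_cong)
    fix t :: real assume t: "t \<in> {-1..1}"
    have 1: "1 - (1 + t) / 2 = (1 - t) / 2" and 2: "t / 2 + 1 / 2 = (1 + t) / 2"
      by (auto simp: field_simps)
    show "2 powr (a + b) / jacobi_normalization a b * ((t / 2 + 1 / 2) powr b * (1 - (t / 2 + 1 / 2)) powr a) = jacobi_density a b t"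
      unfolding 2 1 using t by (simp add: jacobi_density_def jacobi_normalization_def powr_divide powr_add mult_ac)
  qed
  finally have "(jacobi_density a b has_integral integral {-1..1} (jacobi_density a b)) {-1..1}"
    by (rule integrable_integral)
  then have I: "(jacobi_density a b has_integral integral {-1..1} (jacobi_density a b)) UNIV"
    by (rule has_integral_on_superset) (auto simp: jacobi_density_def)
  have "(\<integral>\<^sup>+x. ennreal (jacobi_density a b x) \<partial>lborel) = ennreal (integral {-1..1} (jacobi_density a b))"
    using I jacobi_density_nonneg[OF assms] by (intro nn_integral_has_integral_lborel) auto
  then show ?thesis
    using jacobi_density_nonneg[OF assms] by (intro integrableI_nonneg) auto
qed

lemma finite_measure_jacobi1:
  assumes "a > -1" "b > -1"
  shows "finite_measure (jacobi_measure1 a b)"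
proof
  have "(\<integral>\<^sup>+x. ennreal (jacobi_density a b x) \<partial>lborel) < \<infinity>"
    using jacobi_density_integrable[OF assms] jacobi_density_nonneg[OF assms]
    by (simp add: integrable_iff_bounded)
  then show "emeasure (jacobi_measure1 a b) (space (jacobi_measure1 a b)) \<noteq> \<infinity>"
    by (auto simp: jacobi_measure1_def emeasure_density)
qed

lemma AE_jacobi1:
  "AE x in jacobi_measure1 a b. x \<in> {-1..1}"
  unfolding jacobi_measure1_def by (subst AE_density) (auto simp: jacobi_density_def indicator_def)

lemma sets_jacobi1 [measurable_cong, simp]: "sets (jacobi_measure1 a b) = sets borel"
  and space_jacobi1 [simp]: "space (jacobi_measure1 a b) = UNIV"
  by (auto simp: jacobi_measure1_def)

lemma integrable_jacobi1:
  fixes f :: "real \<Rightarrow> real"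
  assumes "a > -1" "b > -1" "continuous_on UNIV f"
  shows "integrable (jacobi_measure1 a b) f"
proof -
  interpret finite_measure "jacobi_measure1 a b" by (rule finite_measure_jacobi1) fact+
  have "compact (f ` {-1..1})"
    by (intro compact_continuous_image continuous_on_subset[OF assms(3)]) auto
  then obtain B where "\<And>x. x \<in> {-1..1} \<Longrightarrow> \<bar>f x\<bar> \<le> B"
    by (force dest!: compact_imp_bounded simp: bounded_iff)
  note B = this
  have "AE x in jacobi_measure1 a b. norm (f x) \<le> B"
    using AE_jacobi1[of a b] by eventually_elim (simp add: B)
  moreover have "f \<in> borel_measurable (jacobi_measure1 a b)"
    using assms(3) by (simp add: borel_measurable_continuous_onI cong: measurable_cong_sets)
  ultimately show ?thesis
    by (intro integrable_const_bound[of _ B]) auto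
qed

text \<open>
  Translates integrals over the Jacobi measure into gauge integrals with the unnormalised weight,
  to which the fundamental theorem of calculus applies.
\<close>

lemma jacobi1_has_integral:
  fixes f :: "real \<Rightarrow> real"
  assumes ab: "a > -1" "b > -1" and f: "continuous_on UNIV f"
  shows "((\<lambda>t. (1 - t) powr a * (1 + t) powr b * f t) has_integral
           jacobi_normalization a b * (\<integral>x. f x \<partial>jacobi_measure1 a b)) {-1..1}"
proof -
  have [measurable]: "f \<in> borel_measurable borel"
    using f by (rule borel_measurable_continuous_onI)
  have "integrable lborel (\<lambda>x. jacobi_density a b x * f x)"
    using integrable_jacobi1[OF ab f] jacobi_density_nonneg[OF ab]
    unfolding jacobi_measure1_def by (subst (asm) integrable_density) auto
  from has_integral_integral_lborel[OF this]
  have "((\<lambda>x. jacobi_density a b x * f x) has_integral (\<integral>x. f x \<partial>jacobi_measure1 a b)) UNIV"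
    using jacobi_density_nonneg[OF ab] unfolding jacobi_measure1_def
    by (subst integral_density) auto
  from has_integral_mult_right[OF this, of "jacobi_normalization a b"]
  have "((\<lambda>x. jacobi_normalization a b * (jacobi_density a b x * f x)) has_integral
           jacobi_normalization a b * (\<integral>x. f x \<partial>jacobi_measure1 a b)) UNIV" .
  also have "(\<lambda>x. jacobi_normalization a b * (jacobi_density a b x * f x))
      = (\<lambda>x. if x \<in> {-1..1} then (1 - x) powr a * (1 + x) powr b * f x else 0)"
  proof -
    have "Beta (a + 1) (b + 1) \<noteq> 0"
      using jacobi_normalization_pos[OF ab] by (auto simp: jacobi_normalization_def)
    then show ?thesis
      by (auto simp: jacobi_density_def jacobi_normalization_def indicator_def)
  qed
  finally show ?thesis
    by (simp only: has_integral_restrict_UNIV)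
qed

text \<open>
  With \<open>s = r q' - q r'\<close>, the difference \<open>r L q - q L r\<close> times the weight is the derivative of
  \<open>(1 - t) powr (a + 1) * (1 + t) powr (b + 1) * s\<close>, a function that vanishes at both end points.
\<close>

lemma jacobi_operator_symmetric:
  assumes ab: "a > -1" "b > -1"
  shows "(\<integral>x. poly r x * poly (jacobi_operator a b q) x \<partial>jacobi_measure1 a b)
       = (\<integral>x. poly q x * poly (jacobi_operator a b r) x \<partial>jacobi_measure1 a b)"
proof -
  let ?s = "r * pderiv q - q * pderiv r"
  let ?g = "r * jacobi_operator a b q - q * jacobi_operator a b r"
  have g: "jacobi_raise a b ?s = ?g"
    by (rule poly_ext) (simp add: jacobi_operator_def jacobi_raise_def pderiv_diff pderiv_mult algebra_simps)
  have "((\<lambda>t. (1 - t) powr a * (1 + t) powr b * poly ?g t) has_integral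
     ((1 - 1) powr (a + 1) * (1 + 1) powr (b + 1) * poly ?s 1 -
      (1 - (-1)) powr (a + 1) * (1 + (-1)) powr (b + 1) * poly ?s (-1))) {-1..1}"
  proof (rule fundamental_theorem_of_calculus_interior)
    show "continuous_on {-1..1} (\<lambda>t. (1 - t) powr (a + 1) * (1 + t) powr (b + 1) * poly ?s t)"
      using ab by (intro continuous_intros continuous_on_powr') auto
    fix t :: real assume "t \<in> {-1<..<1}"
    from jacobi_raise_deriv[OF this, of a b ?s]
    show "((\<lambda>t. (1 - t) powr (a + 1) * (1 + t) powr (b + 1) * poly ?s t) has_vector_derivative
        (1 - t) powr a * (1 + t) powr b * poly ?g t) (at t)"
      unfolding g by (simp only: has_real_derivative_iff_has_vector_derivative)
  qed simp
  then have "((\<lambda>t. (1 - t) powr a * (1 + t) powr b * poly ?g t) has_integral 0) {-1..1}"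
    using ab by simp
  moreover have "((\<lambda>t. (1 - t) powr a * (1 + t) powr b * poly ?g t) has_integral
       jacobi_normalization a b * (\<integral>x. poly ?g x \<partial>jacobi_measure1 a b)) {-1..1}"
    by (rule jacobi1_has_integral[OF ab]) (intro continuous_intros)
  ultimately have "0 = jacobi_normalization a b * (\<integral>x. poly ?g x \<partial>jacobi_measure1 a b)"
    by (rule has_integral_unique)
  then have "(\<integral>x. poly ?g x \<partial>jacobi_measure1 a b) = 0"
    using jacobi_normalization_pos[OF ab] by simp
  moreover have "(\<integral>x. poly ?g x \<partial>jacobi_measure1 a b)
      = (\<integral>x. poly r x * poly (jacobi_operator a b q) x \<partial>jacobi_measure1 a b)
       - (\<integral>x. poly q x * poly (jacobi_operator a b r) x \<partial>jacobi_measure1 a b)"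
    unfolding poly_diff poly_mult
    by (intro Bochner_Integration.integral_diff integrable_jacobi1 ab continuous_intros)
  ultimately show ?thesis by simp
qed

lemma jacobi1_integral_square_pos:
  assumes ab: "a > -1" "b > -1" and q: "q \<noteq> 0"
  shows "(\<integral>x. (poly q x)\<^sup>2 \<partial>jacobi_measure1 a b) > 0"
proof (rule ccontr)
  assume "\<not> ?thesis"
  moreover have "(\<integral>x. (poly q x)\<^sup>2 \<partial>jacobi_measure1 a b) \<ge> 0" by simp
  ultimately have "(\<integral>x. (poly q x)\<^sup>2 \<partial>jacobi_measure1 a b) = 0" by linarith
  moreover have "integrable (jacobi_measure1 a b) (\<lambda>x. (poly q x)\<^sup>2)"
    by (intro integrable_jacobi1 ab continuous_intros)
  ultimately have "AE x in jacobi_measure1 a b. (poly q x)\<^sup>2 = 0"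
    by (subst (asm) integral_nonneg_eq_0_iff_AE) auto
  then have 1: "AE x in lborel. jacobi_density a b x > 0 \<longrightarrow> poly q x = 0"
    unfolding jacobi_measure1_def by (subst (asm) AE_density) auto
  have 2: "jacobi_density a b x > 0" if "x \<in> {-1<..<1}" for x
    using that jacobi_normalization_pos[OF ab]
    by (auto simp: jacobi_density_def jacobi_normalization_def indicator_def)
  have "AE x in lborel. x \<notin> {x. poly q x = 0}"
    by (intro AE_not_in finite_imp_null_set_lborel poly_roots_finite q)
  with 1 have "AE x in lborel. x \<notin> {-1<..<1::real}"
    by eventually_elim (use 2 in auto)
  then have "{-1<..<1::real} \<in> null_sets lborel"
    by (subst (asm) AE_iff_null_sets[symmetric]) auto
  then show False by auto
qed

text \<open>
  The definite description is justified by existence and uniqueness. Two polynomials that satisfy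
  Rodrigues' formula on an interval are positive multiples of one another, and the
  normalisation of the square integral leaves only one choice of the multiple.
\<close>

lemma jacobi_poly_exists:
  assumes ab: "a > -1" "b > -1" "a + b > -1"
  shows "\<exists>k. k \<noteq> 0 \<and> jacobi_poly n a b = smult k (rodrigues n a b)
    \<and> (\<integral>x. (poly (jacobi_poly n a b) x)\<^sup>2 \<partial>jacobi_measure1 a b) = 1"
proof -
  define R where "R = rodrigues n a b"
  define e where "e = (-1) ^ n / (2 ^ n * fact n :: real)"
  have e: "e \<noteq> 0" by (simp add: e_def)
  have R: "R \<noteq> 0" using rodrigues_degree[OF ab(3)] by (simp add: R_def)
  define I where "I = (\<lambda>q. \<integral>x. (poly q x)\<^sup>2 \<partial>jacobi_measure1 a b)"
  have I_smult: "I (smult c q) = c\<^sup>2 * I q" for c q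
    by (simp add: I_def power_mult_distrib)
  define N where "N = I (smult e R)"
  have N: "N > 0"
    unfolding N_def I_def using ab e R by (intro jacobi1_integral_square_pos) auto
  define Q where "Q q \<longleftrightarrow> (\<exists>c>0. \<forall>x\<in>{-1<..<1}.
                (1 - x) powr a * (1 + x) powr b * c * poly q x =
                  (-1) ^ n / (2 ^ n * fact n) *
                  (deriv ^^ n) (\<lambda>t. (1 - t) powr (a + real n) * (1 + t) powr (b + real n)) x)
           \<and> I q = 1" for q :: "real poly"
  have Q_iff: "Q q \<longleftrightarrow> (\<exists>c>0. smult c q = smult e R) \<and> I q = 1" for q
  proof -
    have "(\<forall>x\<in>{-1<..<1}.
                (1 - x) powr a * (1 + x) powr b * c * poly q x =
                  (-1) ^ n / (2 ^ n * fact n) *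
                  (deriv ^^ n) (\<lambda>t. (1 - t) powr (a + real n) * (1 + t) powr (b + real n)) x)
         \<longleftrightarrow> (\<forall>x\<in>{-1<..<1}. poly (smult c q) x = poly (smult e R) x)" for c
    proof (intro ball_cong refl)
      fix x :: real assume x: "x \<in> {-1<..<1}"
      define W where "W = (1 - x) powr a * (1 + x) powr b"
      have "W \<noteq> 0" using x by (simp add: W_def)
      have "(W * c * poly q x = e * (W * poly R x)) = (W * (c * poly q x) = W * (e * poly R x))"
        by (simp only: mult_ac)
      with \<open>W \<noteq> 0\<close> have "(W * c * poly q x = e * (W * poly R x)) = (poly (smult c q) x = poly (smult e R) x)"
        by simp
      then show "((1 - x) powr a * (1 + x) powr b * c * poly q x =
                  (-1) ^ n / (2 ^ n * fact n) *
                  (deriv ^^ n) (\<lambda>t. (1 - t) powr (a + real n) * (1 + t) powr (b + real n)) x)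
         = (poly (smult c q) x = poly (smult e R) x)"
        unfolding rodrigues_formula[OF x] W_def e_def R_def .
    qed
    also have "\<dots> c \<longleftrightarrow> smult c q = smult e R" for c
    proof
      assume "\<forall>x\<in>{-1<..<1}. poly (smult c q) x = poly (smult e R) x"
      then have "{-1<..<1} \<subseteq> {x. poly (smult c q - smult e R) x = 0}" by auto
      then have "infinite {x. poly (smult c q - smult e R) x = 0}"
        by (rule infinite_super) (rule infinite_Ioo, simp)
      then show "smult c q = smult e R"
        using poly_roots_finite[of "smult c q - smult e R"] by auto
    qed auto
    finally show ?thesis by (simp add: Q_def)
  qed
  define P where "P = smult (e / sqrt N) R"
  have "Q P"
    unfolding Q_iff
  proof
    show "\<exists>c>0. smult c P = smult e R"
      using N by (intro exI[of _ "sqrt N"]) (auto simp: P_def)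
    have "I P = I (smult (1 / sqrt N) (smult e R))" by (simp add: P_def)
    also have "\<dots> = (1 / sqrt N)\<^sup>2 * I (smult e R)" by (rule I_smult)
    also have "\<dots> = (1 / sqrt N)\<^sup>2 * N" by (simp only: N_def)
    also have "\<dots> = 1" using N by (simp add: power_divide)
    finally show "I P = 1" .
  qed
  moreover have "q = P" if qQ: "Q q" for q
  proof -
    obtain c where c: "c > 0" "smult c q = smult e R" and q: "I q = 1"
      using qQ unfolding Q_iff by blast
    have "c\<^sup>2 = N"
      using I_smult[of c q] q by (simp add: c(2) N_def)
    then have "c = sqrt N" using c by (metis real_sqrt_unique less_imp_le)
    then have "P = smult (1 / c) (smult e R)" by (simp add: P_def)
    also have "\<dots> = smult (1 / c) (smult c q)" by (simp only: c(2))
    finally show ?thesis using c(1) by simp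
  qed
  ultimately have "(THE q. Q q) = P" by (rule the_equality)
  then have "jacobi_poly n a b = P"
    unfolding jacobi_poly_def Q_def I_def .
  then show ?thesis
    using \<open>Q P\<close> N e by (intro exI[of _ "e / sqrt N"]) (auto simp: P_def R_def Q_def I_def)
qed

lemma
  assumes ab: "a > -1" "b > -1" "a + b > -1"
  shows jacobi_poly_degree: "degree (jacobi_poly n a b) = n"
    and jacobi_poly_nonzero: "jacobi_poly n a b \<noteq> 0"
    and jacobi_poly_eigen: "jacobi_operator a b (jacobi_poly n a b)
      = smult (- (real n * (real n + a + b + 1))) (jacobi_poly n a b)"
  using jacobi_poly_exists[OF ab, of n] rodrigues_degree[OF ab(3), of n]
  by (auto simp: jacobi_operator_smult rodrigues_eigen mult.commute)

text \<open>
  Eigenfunctions of a symmetric operator for different eigenvalues are orthogonal. The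
  eigenvalues \<open>n (n + a + b + 1)\<close> are pairwise different since \<open>a + b > -1\<close>.
\<close>

lemma jacobi_poly_orthonormal:
  assumes ab: "a > -1" "b > -1" "a + b > -1"
  shows "(\<integral>x. poly (jacobi_poly m a b) x * poly (jacobi_poly n a b) x \<partial>jacobi_measure1 a b)
    = (if m = n then 1 else 0)"
proof (cases "m = n")
  case True
  then show ?thesis
    using jacobi_poly_exists[OF ab, of n] by (auto simp: power2_eq_square)
next
  case False
  define l where "l n = real n * (real n + a + b + 1)" for n
  have "l m - l n = (real m - real n) * (real m + real n + a + b + 1)"
    by (simp add: l_def algebra_simps)
  moreover have "real m + real n \<ge> 1" using False by linarith
  ultimately have l: "l m \<noteq> l n" using False ab by auto
  let ?J = "\<integral>x. poly (jacobi_poly m a b) x * poly (jacobi_poly n a b) x \<partial>jacobi_measure1 a b"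
  have eig: "poly (jacobi_operator a b (jacobi_poly k a b)) x = - l k * poly (jacobi_poly k a b) x" for k x
    by (simp add: jacobi_poly_eigen[OF ab] l_def)
  have "- l n * ?J = (\<integral>x. poly (jacobi_poly m a b) x * poly (jacobi_operator a b (jacobi_poly n a b)) x \<partial>jacobi_measure1 a b)"
    unfolding eig by (simp add: mult.left_commute)
  also have "\<dots> = (\<integral>x. poly (jacobi_poly n a b) x * poly (jacobi_operator a b (jacobi_poly m a b)) x \<partial>jacobi_measure1 a b)"
    by (rule jacobi_operator_symmetric[OF ab(1,2)])
  also have "\<dots> = - l m * ?J"
    unfolding eig by (simp add: mult_ac)
  finally have "- l n * ?J = - l m * ?J" .
  then show ?thesis using l False by simp
qed

text \<open>
  There is one Jacobi polynomial in each degree, so the leading term can be removed repeatedly.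
\<close>

lemma jacobi_poly_span:
  assumes ab: "a > -1" "b > -1" "a + b > -1"
  assumes "degree q \<le> n"
  shows "\<exists>c. q = (\<Sum>j\<le>n. smult (c j) (jacobi_poly j a b))"
  using assms(4)
proof (induction n arbitrary: q)
  case (0 q)
  obtain u where u: "q = [:u:]" using 0 by (metis degree_eq_zeroE le_zero_eq)
  obtain v where v: "jacobi_poly 0 a b = [:v:]" by (rule degree_eq_zeroE[OF jacobi_poly_degree[OF ab, of 0]])
  have "v \<noteq> 0" using v jacobi_poly_nonzero[OF ab, of 0] by auto
  then show ?case using u v by (intro exI[of _ "\<lambda>_. u / v"]) simp
next
  case (Suc n q)
  let ?P = "jacobi_poly (Suc n) a b"
  define d where "d = coeff q (Suc n) / coeff ?P (Suc n)"
  have P: "coeff ?P (Suc n) \<noteq> 0"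
    using jacobi_poly_degree[OF ab, of "Suc n"] jacobi_poly_nonzero[OF ab, of "Suc n"]
    by (metis leading_coeff_0_iff)
  have "degree (q - smult d ?P) \<le> n"
  proof (rule degree_le, intro allI impI)
    fix i assume "n < i"
    then consider "i = Suc n" | "i > Suc n" by linarith
    then show "coeff (q - smult d ?P) i = 0"
      using P Suc.prems jacobi_poly_degree[OF ab, of "Suc n"] by cases (auto simp: d_def coeff_eq_0)
  qed
  from Suc.IH[OF this] obtain c where c: "q - smult d ?P = (\<Sum>j\<le>n. smult (c j) (jacobi_poly j a b))" ..
  have "(\<Sum>j\<le>Suc n. smult ((c(Suc n := d)) j) (jacobi_poly j a b)) = (\<Sum>j\<le>n. smult (c j) (jacobi_poly j a b)) + smult d ?P"
    by simp
  also have "\<dots> = q" by (simp flip: c)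
  finally show ?case by metis
qed

section \<open>Dissipativity in one variable\<close>

lemma signed_powr_deriv:
  fixes u p :: real
  assumes "1 < p" "u \<noteq> 0"
  shows "((\<lambda>u. sgn u * \<bar>u\<bar> powr (p - 1)) has_real_derivative (p - 1) * \<bar>u\<bar> powr (p - 2)) (at u)"
proof (cases "u > 0")
  case True
  have "((\<lambda>u. u powr (p - 1)) has_real_derivative (p - 1) * u powr (p - 2)) (at u)"
    using True by (auto intro!: derivative_eq_intros)
  moreover have "\<forall>\<^sub>F u in nhds u. sgn u * \<bar>u\<bar> powr (p - 1) = u powr (p - 1)"
    using eventually_nhds_in_open[of "{0<..}" u] True by (auto elim!: eventually_mono)
  ultimately show ?thesis
    using True by (subst DERIV_cong_ev[OF refl _ refl]) auto
next
  case False
  then have u: "u < 0" using assms by auto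
  have "((\<lambda>u. - ((- u) powr (p - 1))) has_real_derivative (p - 1) * (- u) powr (p - 2)) (at u)"
    using u by (auto intro!: derivative_eq_intros)
  moreover have "\<forall>\<^sub>F u in nhds u. sgn u * \<bar>u\<bar> powr (p - 1) = - ((- u) powr (p - 1))"
    using eventually_nhds_in_open[of "{..<0}" u] u by (auto elim!: eventually_mono)
  ultimately show ?thesis
    using u by (subst DERIV_cong_ev[OF refl _ refl]) auto
qed

lemma continuous_on_signed_powr:
  fixes f :: "'a::topological_space \<Rightarrow> real"
  assumes "1 < p" "continuous_on S f"
  shows "continuous_on S (\<lambda>x. sgn (f x) * \<bar>f x\<bar> powr (p - 1))"
proof -
  have "continuous_on UNIV (\<lambda>u::real. (max u 0) powr (p - 1) - (max (- u) 0) powr (p - 1))"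
    using assms by (intro continuous_intros continuous_on_powr') auto
  also have "(\<lambda>u::real. (max u 0) powr (p - 1) - (max (- u) 0) powr (p - 1)) = (\<lambda>u. sgn u * \<bar>u\<bar> powr (p - 1))"
    by (auto simp: max_def sgn_real_def)
  finally show ?thesis
    using continuous_on_compose2[OF _ assms(2)] by blast
qed

text \<open>
  Integration by parts against \<open>h q\<close> with \<open>h u = sgn u * \<bar>u\<bar> powr (p - 1)\<close>: since \<open>h\<close> is
  nondecreasing, the remaining integrand \<open>E\<close> is nonnegative. For \<open>p < 2\<close> the function \<open>h\<close> is not
  differentiable at \<open>0\<close>, but a nonzero polynomial has finitely many zeros, and the fundamental
  theorem of calculus tolerates finitely many exceptional points.
\<close>

lemma jacobi_operator_dissipative:
  assumes ab: "a > -1" "b > -1" and p: "1 < p"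
  shows "(\<integral>x. sgn (poly q x) * \<bar>poly q x\<bar> powr (p - 1) * poly (jacobi_operator a b q) x \<partial>jacobi_measure1 a b) \<le> 0"
proof (cases "q = 0")
  case False
  define h where "h u = sgn u * \<bar>u\<bar> powr (p - 1)" for u :: real
  have h_cont: "continuous_on A (\<lambda>x. h (poly q x))" for A
    unfolding h_def using p by (intro continuous_on_signed_powr continuous_intros)
  define F where "F t = h (poly q t) * ((1 - t) powr (a + 1) * (1 + t) powr (b + 1) * poly (pderiv q) t)" for t
  define E where "E t = (p - 1) * \<bar>poly q t\<bar> powr (p - 2) * ((1 - t) powr (a + 1) * (1 + t) powr (b + 1) * (poly (pderiv q) t)\<^sup>2)" for t
  let ?w = "\<lambda>t. (1 - t) powr a * (1 + t) powr b * (h (poly q t) * poly (jacobi_operator a b q) t)"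
  have "((\<lambda>t. ?w t + E t) has_integral (F 1 - F (-1))) {-1..1}"
  proof (rule fundamental_theorem_of_calculus_interior_strong)
    show "finite {x. poly q x = 0}" using False by (rule poly_roots_finite)
    show "continuous_on {-1..1} F"
      unfolding F_def using ab by (intro continuous_intros continuous_on_powr' h_cont) auto
    fix t :: real assume t: "t \<in> {-1<..<1} - {x. poly q x = 0}"
    have 1: "((\<lambda>t. h (poly q t)) has_real_derivative (p - 1) * \<bar>poly q t\<bar> powr (p - 2) * poly (pderiv q) t) (at t)"
      using t p unfolding h_def by (intro DERIV_chain2[OF signed_powr_deriv poly_DERIV]) auto
    have 2: "((\<lambda>t. (1 - t) powr (a + 1) * (1 + t) powr (b + 1) * poly (pderiv q) t) has_real_derivative
      (1 - t) powr a * (1 + t) powr b * poly (jacobi_operator a b q) t) (at t)"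
      unfolding jacobi_operator_def using t by (intro jacobi_raise_deriv) auto
    have "(F has_real_derivative ?w t + E t) (at t)"
      unfolding F_def by (rule DERIV_cong[OF DERIV_mult[OF 1 2]])
        (simp add: E_def power2_eq_square algebra_simps)
    then show "(F has_vector_derivative ?w t + E t) (at t)"
      by (simp only: has_real_derivative_iff_has_vector_derivative)
  qed simp
  then have 1: "((\<lambda>t. ?w t + E t) has_integral 0) {-1..1}"
    using ab by (simp add: F_def)
  have 2: "(?w has_integral jacobi_normalization a b * (\<integral>x. h (poly q x) * poly (jacobi_operator a b q) x \<partial>jacobi_measure1 a b)) {-1..1}"
    by (intro jacobi1_has_integral ab continuous_intros h_cont)
  have "jacobi_normalization a b * (\<integral>x. h (poly q x) * poly (jacobi_operator a b q) x \<partial>jacobi_measure1 a b) \<le> 0"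
    by (rule has_integral_le[OF 2 1]) (use p in \<open>auto simp: E_def\<close>)
  then show ?thesis
    using jacobi_normalization_pos[OF ab] by (simp add: h_def mult_le_0_iff)
qed simp

section \<open>The Jacobi measure as a product measure\<close>

lemma nn_integral_lborel_vec:
  fixes g :: "'d::finite \<Rightarrow> real \<Rightarrow> ennreal"
  assumes [measurable]: "\<And>i. g i \<in> borel_measurable borel"
  shows "(\<integral>\<^sup>+x. (\<Prod>i\<in>UNIV. g i (x $ i)) \<partial>lborel) = (\<Prod>i\<in>UNIV. \<integral>\<^sup>+t. g i t \<partial>lborel)"
proof -
  define ax where "ax i = axis i (1::real)" for i :: 'd
  have inj: "inj ax"
    by (auto simp: inj_def ax_def axis_eq_axis)
  have Basis: "(Basis :: (real ^ 'd) set) = range ax"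
    by (auto simp: Basis_vec_def ax_def)
  have "(\<integral>\<^sup>+x. (\<Prod>b\<in>Basis. g (inv ax b) (x \<bullet> b)) \<partial>lborel) = (\<Prod>b\<in>Basis. \<integral>\<^sup>+t. g (inv ax b) t \<partial>lborel)"
    by (rule nn_integral_lborel_prod) auto
  then show ?thesis
    unfolding Basis by (simp add: prod.reindex inj inv_f_f[OF inj]) (simp add: ax_def inner_axis)
qed

text \<open>
  The condition \<open>\<alpha>\<^sub>i > -1\<close>, \<open>\<beta>\<^sub>i > -1\<close> makes the measure finite; \<open>\<alpha>\<^sub>i + \<beta>\<^sub>i > -1\<close> makes the
  eigenvalue nonnegative and strictly increasing in each component of the index.
\<close>

locale jacobi =
  fixes \<alpha> \<beta> :: "real ^ 'd::finite"
  assumes alpha: "\<And>i. \<alpha> $ i > -1" and beta: "\<And>i. \<beta> $ i > -1"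
    and alpha_beta: "\<And>i. \<alpha> $ i + \<beta> $ i > -1"
begin

abbreviation "\<mu> \<equiv> jacobi_measure \<alpha> \<beta>"
abbreviation "\<mu>1 i \<equiv> jacobi_measure1 (\<alpha> $ i) (\<beta> $ i)"
abbreviation "e \<equiv> jacobi_vec \<alpha> \<beta>"
abbreviation "ev \<equiv> jacobi_eigenvalue \<alpha> \<beta>"

lemma density_nonneg: "0 \<le> jacobi_density (\<alpha> $ i) (\<beta> $ i) t"
  by (rule jacobi_density_nonneg[OF alpha beta])

lemma sets_jacobi_measure [measurable_cong, simp]: "sets \<mu> = sets borel"
  and space_jacobi_measure [simp]: "space \<mu> = UNIV"
  by (auto simp: jacobi_measure_def)

lemma emeasure_jacobi_box:
  assumes [measurable]: "\<And>i. A i \<in> sets borel"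
  shows "emeasure \<mu> {x. \<forall>i. x $ i \<in> A i} = (\<Prod>i\<in>UNIV. emeasure (\<mu>1 i) (A i))"
proof -
  have "{x. \<forall>i. x $ i \<in> A i} \<in> sets (borel :: (real ^ 'd) measure)"
    by measurable
  then have "emeasure \<mu> {x. \<forall>i. x $ i \<in> A i} =
      (\<integral>\<^sup>+x. ennreal (\<Prod>i\<in>UNIV. jacobi_density (\<alpha> $ i) (\<beta> $ i) (x $ i)) * indicator {x. \<forall>i. x $ i \<in> A i} x \<partial>lborel)"
    unfolding jacobi_measure_def by (intro emeasure_density) auto
  also have "\<dots> = (\<integral>\<^sup>+x. (\<Prod>i\<in>UNIV. ennreal (jacobi_density (\<alpha> $ i) (\<beta> $ i) (x $ i)) * indicator (A i) (x $ i)) \<partial>lborel)"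
  proof (intro nn_integral_cong)
    fix x :: "real ^ 'd"
    have "indicator {x. \<forall>i. x $ i \<in> A i} x = (\<Prod>i\<in>UNIV. indicator (A i) (x $ i) :: ennreal)"
      by (auto simp: indicator_def)
    then show "ennreal (\<Prod>i\<in>UNIV. jacobi_density (\<alpha> $ i) (\<beta> $ i) (x $ i)) * indicator {x. \<forall>i. x $ i \<in> A i} x
        = (\<Prod>i\<in>UNIV. ennreal (jacobi_density (\<alpha> $ i) (\<beta> $ i) (x $ i)) * indicator (A i) (x $ i))"
      by (simp only: prod.distrib) (simp add: prod_ennreal density_nonneg)
  qed
  also have "\<dots> = (\<Prod>i\<in>UNIV. \<integral>\<^sup>+t. ennreal (jacobi_density (\<alpha> $ i) (\<beta> $ i) t) * indicator (A i) t \<partial>lborel)"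
    by (rule nn_integral_lborel_vec) auto
  also have "\<dots> = (\<Prod>i\<in>UNIV. emeasure (\<mu>1 i) (A i))"
    by (intro prod.cong refl) (simp add: jacobi_measure1_def emeasure_density)
  finally show ?thesis .
qed

lemma finite_measure_jacobi: "finite_measure \<mu>"
proof
  have "emeasure \<mu> {x. \<forall>i. x $ i \<in> UNIV} = (\<Prod>i\<in>UNIV. emeasure (\<mu>1 i) UNIV)"
    by (rule emeasure_jacobi_box) auto
  moreover have "emeasure (\<mu>1 i) UNIV \<noteq> \<infinity>" for i
    using finite_measure.emeasure_finite[OF finite_measure_jacobi1[OF alpha beta]] by simp
  ultimately show "emeasure \<mu> (space \<mu>) \<noteq> \<infinity>"
    by (simp add: ennreal_prod_eq_top)
qed

lemma AE_jacobi_cube: "AE x in \<mu>. x \<in> cbox (\<chi> i. -1) (\<chi> i. 1)"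
proof -
  have "AE x in lborel. 0 < (\<Prod>i\<in>UNIV. jacobi_density (\<alpha> $ i) (\<beta> $ i) (x $ i)) \<longrightarrow>
      x \<in> cbox (\<chi> i. -1) (\<chi> i. 1)"
  proof (intro AE_I2 impI)
    fix x :: "real ^ 'd"
    assume "0 < (\<Prod>i\<in>UNIV. jacobi_density (\<alpha> $ i) (\<beta> $ i) (x $ i))"
    then have "jacobi_density (\<alpha> $ i) (\<beta> $ i) (x $ i) \<noteq> 0" for i
      by (metis UNIV_I finite less_irrefl prod_zero_iff)
    then have "x $ i \<in> {-1..1}" for i
      by (auto simp: jacobi_density_def indicator_def split: if_splits)
    then show "x \<in> cbox (\<chi> i. -1) (\<chi> i. 1)"
      by (auto simp: mem_box_cart)
  qed
  then show ?thesis
    unfolding jacobi_measure_def by (subst AE_density) auto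
qed

sublocale product_sigma_finite \<mu>1
  by (intro product_sigma_finite.intro finite_measure.axioms(1) finite_measure_jacobi1 alpha beta)

lemma measurable_vec_nth': "vec_nth \<in> measurable \<mu> (Pi\<^sub>M UNIV \<mu>1)"
proof -
  have "(\<lambda>x i. x $ i) \<in> measurable \<mu> (Pi\<^sub>M UNIV \<mu>1)"
    by (rule measurable_PiM_single') auto
  then show ?thesis by simp
qed

text \<open>
  This identification gives access to Fubini's theorem in a single coordinate.
\<close>

lemma PiM_jacobi: "distr \<mu> (Pi\<^sub>M UNIV \<mu>1) vec_nth = Pi\<^sub>M UNIV \<mu>1"
proof (rule PiM_eqI)
  fix A assume "\<And>i. i \<in> UNIV \<Longrightarrow> A i \<in> sets (\<mu>1 i)"
  then have A: "A i \<in> sets borel" for i by auto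
  have "emeasure (distr \<mu> (Pi\<^sub>M UNIV \<mu>1) vec_nth) (Pi\<^sub>E UNIV A) = emeasure \<mu> (vec_nth -` Pi\<^sub>E UNIV A \<inter> space \<mu>)"
    using A by (intro emeasure_distr measurable_vec_nth' sets_PiM_I_finite) auto
  also have "vec_nth -` Pi\<^sub>E UNIV A \<inter> space \<mu> = {x. \<forall>i. x $ i \<in> A i}"
    by (auto simp: PiE_iff)
  finally show "emeasure (distr \<mu> (Pi\<^sub>M UNIV \<mu>1) vec_nth) (Pi\<^sub>E UNIV A) = (\<Prod>i\<in>UNIV. emeasure (\<mu>1 i) (A i))"
    using emeasure_jacobi_box[OF A] by simp
qed auto

lemma measurable_vec_lambda' [measurable]: "vec_lambda \<in> measurable (Pi\<^sub>M UNIV \<mu>1) (borel :: (real ^ 'd) measure)"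
proof (subst borel_measurable_euclidean_space, intro ballI)
  fix b :: "real ^ 'd" assume "b \<in> Basis"
  then obtain i where b: "b = axis i 1" by (auto simp: Basis_vec_def)
  have "(\<lambda>w. w i) \<in> borel_measurable (Pi\<^sub>M UNIV \<mu>1)"
    using measurable_component_singleton[of i UNIV \<mu>1] by (simp cong: measurable_cong_sets)
  then show "(\<lambda>w. vec_lambda w \<bullet> b) \<in> borel_measurable (Pi\<^sub>M UNIV \<mu>1)"
    by (simp add: b inner_axis)
qed

lemma integral_jacobi_PiM:
  fixes f :: "real ^ 'd \<Rightarrow> real"
  assumes [measurable]: "f \<in> borel_measurable borel"
  shows "(\<integral>x. f x \<partial>\<mu>) = (\<integral>w. f (vec_lambda w) \<partial>Pi\<^sub>M UNIV \<mu>1)"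
    and "integrable \<mu> f \<longleftrightarrow> integrable (Pi\<^sub>M UNIV \<mu>1) (\<lambda>w. f (vec_lambda w))"
proof -
  have m: "(\<lambda>w. f (vec_lambda w)) \<in> borel_measurable (Pi\<^sub>M UNIV \<mu>1)"
    by measurable
  show "(\<integral>x. f x \<partial>\<mu>) = (\<integral>w. f (vec_lambda w) \<partial>Pi\<^sub>M UNIV \<mu>1)"
    using integral_distr[OF measurable_vec_nth' m] by (simp add: PiM_jacobi)
  show "integrable \<mu> f \<longleftrightarrow> integrable (Pi\<^sub>M UNIV \<mu>1) (\<lambda>w. f (vec_lambda w))"
    using integrable_distr_eq[OF measurable_vec_nth' m] by (simp add: PiM_jacobi)
qed

lemma integrable_jacobi:
  fixes f :: "real ^ 'd \<Rightarrow> real"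
  assumes "continuous_on UNIV f"
  shows "integrable \<mu> f"
proof -
  interpret finite_measure \<mu> by (rule finite_measure_jacobi)
  have "compact (f ` cbox (\<chi> i. -1) (\<chi> i. 1))"
    by (intro compact_continuous_image continuous_on_subset[OF assms]) auto
  then obtain B where B: "\<And>x. x \<in> cbox (\<chi> i. -1) (\<chi> i. 1) \<Longrightarrow> \<bar>f x\<bar> \<le> B"
    by (force dest!: compact_imp_bounded simp: bounded_iff)
  have "AE x in \<mu>. norm (f x) \<le> B"
    using AE_jacobi_cube by eventually_elim (simp add: B)
  moreover have "f \<in> borel_measurable \<mu>"
    using assms by (simp add: borel_measurable_continuous_onI cong: measurable_cong_sets)
  ultimately show ?thesis
    by (intro integrable_const_bound[of _ B]) auto
qed

lemma continuous_on_jacobi_vec [continuous_intros]: "continuous_on A (e \<kappa>)"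
  unfolding jacobi_vec_def by (intro continuous_intros)

lemma jacobi_vec_orthonormal: "(\<integral>x. e \<kappa> x * e \<kappa>' x \<partial>\<mu>) = (if \<kappa> = \<kappa>' then 1 else 0)"
proof -
  let ?p = "\<lambda>i n. poly (jacobi_poly n (\<alpha> $ i) (\<beta> $ i))"
  have "continuous_on UNIV (\<lambda>x. e \<kappa> x * e \<kappa>' x)"
    by (intro continuous_intros)
  then have "(\<integral>x. e \<kappa> x * e \<kappa>' x \<partial>\<mu>) = (\<integral>w. e \<kappa> (vec_lambda w) * e \<kappa>' (vec_lambda w) \<partial>Pi\<^sub>M UNIV \<mu>1)"
    by (intro integral_jacobi_PiM borel_measurable_continuous_onI)
  also have "\<dots> = (\<integral>w. (\<Prod>i\<in>UNIV. ?p i (\<kappa> $ i) (w i) * ?p i (\<kappa>' $ i) (w i)) \<partial>Pi\<^sub>M UNIV \<mu>1)"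
    by (simp add: jacobi_vec_def prod.distrib)
  also have "\<dots> = (\<Prod>i\<in>UNIV. \<integral>t. ?p i (\<kappa> $ i) t * ?p i (\<kappa>' $ i) t \<partial>\<mu>1 i)"
    by (rule product_integral_prod) (auto intro!: integrable_jacobi1 alpha beta continuous_intros)
  also have "\<dots> = (\<Prod>i\<in>UNIV. if \<kappa> $ i = \<kappa>' $ i then 1 else 0)"
    by (simp add: jacobi_poly_orthonormal alpha beta alpha_beta)
  also have "\<dots> = (if \<kappa> = \<kappa>' then 1 else 0)"
    by (auto simp: vec_eq_iff)
  finally show ?thesis .
qed

section \<open>Dissipativity on finite Jacobi expansions\<close>

definition expansion :: "(nat ^ 'd) set \<Rightarrow> (nat ^ 'd \<Rightarrow> real) \<Rightarrow> real ^ 'd \<Rightarrow> real" where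
  "expansion K c x = (\<Sum>\<kappa>\<in>K. c \<kappa> * e \<kappa> x)"

lemma continuous_on_expansion [continuous_intros]: "continuous_on A (expansion K c)"
  unfolding expansion_def by (intro continuous_intros)

text \<open>
  With the other coordinates frozen, an expansion is a polynomial \<open>G\<close> in the \<open>i\<close>-th coordinate, and
  multiplying the coefficients by the \<open>i\<close>-th summand of the eigenvalue amounts to applying
  \<open>- L\<close> to \<open>G\<close>. So the inner integral in Fubini's theorem is nonnegative by the result in one
  variable.
\<close>

lemma dissipative_coordinate:
  assumes p: "1 < p"
  shows "0 \<le> (\<integral>x. sgn (expansion K c x) * \<bar>expansion K c x\<bar> powr (p - 1) *
      expansion K (\<lambda>\<kappa>. real (\<kappa> $ i) * (real (\<kappa> $ i) + \<alpha> $ i + \<beta> $ i + 1) * c \<kappa>) x \<partial>\<mu>)"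
    (is "0 \<le> (\<integral>x. ?F x \<partial>\<mu>)")
proof -
  let ?I = "UNIV - {i}"
  let ?p = "\<lambda>i n. jacobi_poly n (\<alpha> $ i) (\<beta> $ i)"
  have cont: "continuous_on UNIV ?F"
    by (intro continuous_intros continuous_on_signed_powr p)
  have meas: "?F \<in> borel_measurable borel"
    using cont by (rule borel_measurable_continuous_onI)
  have UNIV: "insert i ?I = UNIV" by auto
  have "integrable (Pi\<^sub>M UNIV \<mu>1) (\<lambda>w. ?F (vec_lambda w))"
    using integral_jacobi_PiM(2)[OF meas] integrable_jacobi[OF cont] by blast
  then have "integrable (Pi\<^sub>M (insert i ?I) \<mu>1) (\<lambda>w. ?F (vec_lambda w))"
    unfolding UNIV .
  from product_integral_insert[OF _ _ this]
  have "(\<integral>w. ?F (vec_lambda w) \<partial>Pi\<^sub>M UNIV \<mu>1) = (\<integral>w. (\<integral>y. ?F (vec_lambda (w(i := y))) \<partial>\<mu>1 i) \<partial>Pi\<^sub>M ?I \<mu>1)"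
    unfolding UNIV by simp
  also have "\<dots> \<ge> 0"
  proof (rule Bochner_Integration.integral_nonneg)
    fix w :: "'d \<Rightarrow> real"
    define d where "d \<kappa> = c \<kappa> * (\<Prod>j\<in>?I. poly (?p j (\<kappa> $ j)) (w j))" for \<kappa> :: "nat ^ 'd"
        define G where "G = (\<Sum>\<kappa>\<in>K. smult (d \<kappa>) (?p i (\<kappa> $ i)))"
    have vec: "e \<kappa> (vec_lambda (w(i := y))) = (\<Prod>j\<in>?I. poly (?p j (\<kappa> $ j)) (w j)) * poly (?p i (\<kappa> $ i)) y" for \<kappa> y
      unfolding jacobi_vec_def by (subst prod.remove[of UNIV i]) (auto simp: mult.commute intro!: prod.cong)
    have G: "expansion K c (vec_lambda (w(i := y))) = poly G y" for y
      by (simp add: expansion_def vec G_def d_def poly_sum mult_ac)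
    have LG: "expansion K (\<lambda>\<kappa>. real (\<kappa> $ i) * (real (\<kappa> $ i) + \<alpha> $ i + \<beta> $ i + 1) * c \<kappa>) (vec_lambda (w(i := y)))
        = - poly (jacobi_operator (\<alpha> $ i) (\<beta> $ i) G) y" for y
      by (simp add: expansion_def vec G_def d_def poly_sum jacobi_operator_sum jacobi_operator_smult
          jacobi_poly_eigen[OF alpha beta alpha_beta] sum_negf mult_ac)
    show "0 \<le> (\<integral>y. ?F (vec_lambda (w(i := y))) \<partial>\<mu>1 i)"
      unfolding G LG using jacobi_operator_dissipative[OF alpha[of i] beta[of i] p, of G] by simp
  qed
  finally show ?thesis
    using integral_jacobi_PiM(1)[OF meas] by simp
qed

lemma dissipative:
  assumes p: "1 < p"
  shows "0 \<le> (\<integral>x. sgn (expansion K c x) * \<bar>expansion K c x\<bar> powr (p - 1) *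
      expansion K (\<lambda>\<kappa>. ev \<kappa> * c \<kappa>) x \<partial>\<mu>)"
proof -
  define c' where "c' = (\<lambda>i \<kappa>. real (\<kappa> $ i) * (real (\<kappa> $ i) + \<alpha> $ i + \<beta> $ i + 1) * c \<kappa>)"
  define h where "h x = sgn (expansion K c x) * \<bar>expansion K c x\<bar> powr (p - 1)" for x
  have h: "continuous_on UNIV h"
    unfolding h_def by (intro continuous_intros continuous_on_signed_powr p)
  have "expansion K (\<lambda>\<kappa>. ev \<kappa> * c \<kappa>) x = (\<Sum>i\<in>UNIV. expansion K (c' i) x)" for x
    unfolding expansion_def c'_def
    by (subst sum.swap) (simp add: jacobi_eigenvalue_def sum_distrib_right)
  then have "(\<integral>x. h x * expansion K (\<lambda>\<kappa>. ev \<kappa> * c \<kappa>) x \<partial>\<mu>) = (\<integral>x. (\<Sum>i\<in>UNIV. h x * expansion K (c' i) x) \<partial>\<mu>)"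
    by (simp add: sum_distrib_left)
  also have "\<dots> = (\<Sum>i\<in>UNIV. \<integral>x. h x * expansion K (c' i) x \<partial>\<mu>)"
    by (intro Bochner_Integration.integral_sum integrable_jacobi continuous_intros h)
  also have "\<dots> \<ge> 0"
    unfolding h_def c'_def by (intro sum_nonneg dissipative_coordinate p)
  finally show ?thesis by (simp add: h_def)
qed

lemma eigenvalue_nonneg: "0 \<le> ev \<kappa>"
proof -
  have "0 \<le> real (\<kappa> $ i) * (real (\<kappa> $ i) + \<alpha> $ i + \<beta> $ i + 1)" for i
    using alpha_beta[of i] by (intro mult_nonneg_nonneg) auto
  then show ?thesis unfolding jacobi_eigenvalue_def by (intro sum_nonneg) auto
qed

lemma expansion_Lp:
  assumes "0 < p"
  shows "expansion K c \<in> Lp_space p \<mu>"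
proof -
  have "integrable \<mu> (\<lambda>x. \<bar>expansion K c x\<bar> powr p)"
    using assms by (intro integrable_jacobi continuous_intros continuous_on_powr') auto
  moreover have "expansion K c \<in> borel_measurable \<mu>"
    by (simp add: borel_measurable_continuous_onI continuous_on_expansion cong: measurable_cong_sets)
  ultimately show ?thesis by (simp add: Lp_space_def)
qed

section \<open>Contractive multipliers\<close>

text \<open>
  A function of the index acts on finite expansions as a multiplier; the quantifier over all
  coefficient families makes products of contractive multipliers contractive.
\<close>

definition contractive :: "real \<Rightarrow> (nat ^ 'd \<Rightarrow> real) \<Rightarrow> bool" where
  "contractive p m \<longleftrightarrow> (\<forall>K c. finite K \<longrightarrow>
     pmass p \<mu> (expansion K (\<lambda>\<kappa>. m \<kappa> * c \<kappa>)) \<le> pmass p \<mu> (expansion K c))"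

lemma contractiveD:
  assumes "contractive p m" "finite K"
  shows "pmass p \<mu> (expansion K (\<lambda>\<kappa>. m \<kappa> * c \<kappa>)) \<le> pmass p \<mu> (expansion K c)"
  using assms by (simp add: contractive_def)

text \<open>
  If \<open>f\<close> is the image of \<open>g\<close>, then \<open>g = f - s L f\<close>. Integrating the tangent inequality at \<open>f\<close>,
  evaluated at \<open>g\<close>, shows that the mass of \<open>g\<close> exceeds that of \<open>f\<close> by at least
  \<open>- p s \<integral> sgn f \<bar>f\<bar> powr (p - 1) * L f d\<mu>\<close>, which is nonnegative by dissipativity.
\<close>

lemma contractive_resolvent:
  assumes p: "1 < p" and s: "0 \<le> s"
  shows "contractive p (\<lambda>\<kappa>. 1 / (1 + s * ev \<kappa>))"
  unfolding contractive_def
proof (intro allI impI)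
  fix K :: "(nat ^ 'd) set" and c
  define b where "b = (\<lambda>\<kappa>. 1 / (1 + s * ev \<kappa>) * c \<kappa>)"
  define f where "f = expansion K b"
  define Af where "Af = expansion K (\<lambda>\<kappa>. ev \<kappa> * b \<kappa>)"
  have c: "c \<kappa> = b \<kappa> + s * (ev \<kappa> * b \<kappa>)" for \<kappa>
  proof -
    have "1 + s * ev \<kappa> > 0" using eigenvalue_nonneg[of \<kappa>] s by (simp add: add_pos_nonneg)
    then have "b \<kappa> * (1 + s * ev \<kappa>) = c \<kappa>" by (simp add: b_def)
    then show ?thesis by (simp add: algebra_simps)
  qed
  have g: "expansion K c x = f x + s * Af x" for x
    unfolding f_def Af_def expansion_def
    by (subst c) (simp add: sum.distrib sum_distrib_left algebra_simps)
  have fc: "continuous_on UNIV f" and Afc: "continuous_on UNIV Af"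
    unfolding f_def Af_def by (intro continuous_intros)+
  have c1: "continuous_on UNIV (\<lambda>x. sgn (f x) * \<bar>f x\<bar> powr (p - 1) * Af x)"
    by (intro continuous_intros continuous_on_signed_powr p fc Afc)
  have c2: "continuous_on UNIV (\<lambda>x. \<bar>f x\<bar> powr p)" "continuous_on UNIV (\<lambda>x. \<bar>f x + s * Af x\<bar> powr p)"
    using p by (auto intro!: continuous_intros continuous_on_powr' fc Afc)
  have "pmass p \<mu> f \<le> pmass p \<mu> f + p * s * (\<integral>x. sgn (f x) * \<bar>f x\<bar> powr (p - 1) * Af x \<partial>\<mu>)"
    using dissipative[OF p, of K b] p s by (simp add: f_def Af_def)
  also have "\<dots> = (\<integral>x. \<bar>f x\<bar> powr p + p * s * (sgn (f x) * \<bar>f x\<bar> powr (p - 1) * Af x) \<partial>\<mu>)"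
    using integrable_jacobi[OF c1] integrable_jacobi[OF c2(1)] by (simp add: pmass_def)
  also have "\<dots> \<le> (\<integral>x. \<bar>f x + s * Af x\<bar> powr p \<partial>\<mu>)"
  proof (rule integral_mono)
    fix x
    show "\<bar>f x\<bar> powr p + p * s * (sgn (f x) * \<bar>f x\<bar> powr (p - 1) * Af x) \<le> \<bar>f x + s * Af x\<bar> powr p"
      using abs_powr_tangent[OF p, of "f x" "f x + s * Af x"] by (simp add: mult_ac)
  qed (use integrable_jacobi[OF c1] integrable_jacobi[OF c2(1)] integrable_jacobi[OF c2(2)] in auto)
  also have "\<dots> = pmass p \<mu> (expansion K c)"
    by (simp add: pmass_def g)
  finally show "pmass p \<mu> (expansion K (\<lambda>\<kappa>. 1 / (1 + s * ev \<kappa>) * c \<kappa>)) \<le> pmass p \<mu> (expansion K c)"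
    unfolding f_def b_def .
qed

lemma contractive_power:
  assumes "contractive p m"
  shows "contractive p (\<lambda>\<kappa>. m \<kappa> ^ k)"
proof (induction k)
  case 0
  then show ?case by (simp add: contractive_def)
next
  case (Suc k)
  show ?case
    unfolding contractive_def
  proof (intro allI impI)
    fix K :: "(nat ^ 'd) set" and c assume K: "finite K"
    have "pmass p \<mu> (expansion K (\<lambda>\<kappa>. m \<kappa> * (m \<kappa> ^ k * c \<kappa>))) \<le> pmass p \<mu> (expansion K (\<lambda>\<kappa>. m \<kappa> ^ k * c \<kappa>))"
      by (rule contractiveD[OF assms K])
    also have "\<dots> \<le> pmass p \<mu> (expansion K c)"
      by (rule contractiveD[OF Suc K])
    finally show "pmass p \<mu> (expansion K (\<lambda>\<kappa>. m \<kappa> ^ Suc k * c \<kappa>)) \<le> pmass p \<mu> (expansion K c)"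
      by (simp add: mult.assoc)
  qed
qed

lemma contractive_convex:
  assumes p: "1 < p" and J: "finite J" and m: "\<And>j. j \<in> J \<Longrightarrow> contractive p (m j)"
    and w: "\<And>j. j \<in> J \<Longrightarrow> 0 \<le> w j" "sum w J \<le> 1"
  shows "contractive p (\<lambda>\<kappa>. \<Sum>j\<in>J. w j * m j \<kappa>)"
  unfolding contractive_def
proof (intro allI impI)
  fix K :: "(nat ^ 'd) set" and c assume K: "finite K"
  define g where "g j = expansion K (\<lambda>\<kappa>. m j \<kappa> * c \<kappa>)" for j
  have int: "integrable \<mu> (\<lambda>x. \<bar>g j x\<bar> powr p)" for j
    using expansion_Lp[of p K] p by (auto simp: g_def Lp_space_def)
  have eq: "expansion K (\<lambda>\<kappa>. (\<Sum>j\<in>J. w j * m j \<kappa>) * c \<kappa>) x = (\<Sum>j\<in>J. w j * g j x)" for x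
    unfolding expansion_def g_def sum_distrib_left sum_distrib_right
    by (subst sum.swap) (simp add: mult_ac)
  have "pmass p \<mu> (expansion K (\<lambda>\<kappa>. (\<Sum>j\<in>J. w j * m j \<kappa>) * c \<kappa>)) \<le> (\<integral>x. (\<Sum>j\<in>J. w j * \<bar>g j x\<bar> powr p) \<partial>\<mu>)"
    unfolding pmass_def
  proof (rule integral_mono)
    show "integrable \<mu> (\<lambda>x. \<bar>expansion K (\<lambda>\<kappa>. (\<Sum>j\<in>J. w j * m j \<kappa>) * c \<kappa>) x\<bar> powr p)"
      using expansion_Lp[of p K] p by (auto simp: Lp_space_def)
    show "integrable \<mu> (\<lambda>x. \<Sum>j\<in>J. w j * \<bar>g j x\<bar> powr p)"
      using int by auto
  qed (unfold eq, intro abs_powr_sum_le p J w)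
  also have "\<dots> = (\<Sum>j\<in>J. w j * pmass p \<mu> (g j))"
    using int by (simp add: pmass_def)
  also have "\<dots> \<le> (\<Sum>j\<in>J. w j * pmass p \<mu> (expansion K c))"
    using m w K by (intro sum_mono mult_left_mono) (auto simp: contractive_def g_def)
  also have "\<dots> \<le> pmass p \<mu> (expansion K c)"
    using mult_right_mono[OF w(2) pmass_nonneg[of p \<mu> "expansion K c"]]
    by (simp flip: sum_distrib_right)
  finally show "pmass p \<mu> (expansion K (\<lambda>\<kappa>. (\<Sum>j\<in>J. w j * m j \<kappa>) * c \<kappa>)) \<le> pmass p \<mu> (expansion K c)" .
qed

text \<open>
  For a fixed finite expansion the multiplied expansions converge pointwise and are dominated by
  a continuous function, which is integrable because the measure is finite and lives on the cube.
\<close>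

lemma contractive_limit:
  assumes p: "0 < p" and m: "\<And>n::nat. contractive p (m n)"
    and lim: "\<And>\<kappa>. (\<lambda>n. m n \<kappa>) \<longlonglongrightarrow> m' \<kappa>"
  shows "contractive p m'"
  unfolding contractive_def
proof (intro allI impI)
  fix K :: "(nat ^ 'd) set" and c assume K: "finite K"
  have "\<exists>B. \<forall>n. \<bar>m n \<kappa>\<bar> \<le> B" for \<kappa>
    using convergent_imp_Bseq[OF convergentI[OF lim[of \<kappa>]]] by (auto simp: Bseq_def)
  then obtain B where B: "\<And>n \<kappa>. \<bar>m n \<kappa>\<bar> \<le> B \<kappa>" by metis
  let ?g = "\<lambda>n. expansion K (\<lambda>\<kappa>. m n \<kappa> * c \<kappa>)"
  let ?D = "\<lambda>x. (\<Sum>\<kappa>\<in>K. B \<kappa> * \<bar>c \<kappa>\<bar> * \<bar>e \<kappa> x\<bar>)"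
  have B0: "0 \<le> B \<kappa>" for \<kappa> using B[of 0 \<kappa>] by linarith
  have D0: "0 \<le> ?D x" for x by (intro sum_nonneg) (auto simp: B0)
  have [measurable]: "expansion K d \<in> borel_measurable \<mu>" for d
    using expansion_Lp[of 1 K d] by (auto simp: Lp_space_def)
  have "(\<lambda>n. \<integral>x. \<bar>?g n x\<bar> powr p \<partial>\<mu>) \<longlonglongrightarrow> (\<integral>x. \<bar>expansion K (\<lambda>\<kappa>. m' \<kappa> * c \<kappa>) x\<bar> powr p \<partial>\<mu>)"
  proof (rule integral_dominated_convergence)
    show "integrable \<mu> (\<lambda>x. ?D x powr p)"
      using p D0 by (intro integrable_jacobi continuous_on_powr' continuous_intros) auto
    show "AE x in \<mu>. (\<lambda>n. \<bar>?g n x\<bar> powr p) \<longlonglongrightarrow> \<bar>expansion K (\<lambda>\<kappa>. m' \<kappa> * c \<kappa>) x\<bar> powr p"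
      using p lim unfolding expansion_def by (intro AE_I2 tendsto_powr' tendsto_intros) auto
    show "AE x in \<mu>. norm (\<bar>?g n x\<bar> powr p) \<le> ?D x powr p" for n
    proof (intro AE_I2)
      fix x
      have "\<bar>?g n x\<bar> \<le> (\<Sum>\<kappa>\<in>K. \<bar>m n \<kappa> * c \<kappa> * e \<kappa> x\<bar>)"
        unfolding expansion_def by (rule sum_abs)
      also have "\<dots> \<le> ?D x"
        by (intro sum_mono) (auto simp: abs_mult intro!: mult_right_mono B)
      finally show "norm (\<bar>?g n x\<bar> powr p) \<le> ?D x powr p"
        using p by (auto intro!: powr_mono2)
    qed
  qed auto
  then show "pmass p \<mu> (expansion K (\<lambda>\<kappa>. m' \<kappa> * c \<kappa>)) \<le> pmass p \<mu> (expansion K c)"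
    using m K by (intro LIMSEQ_le_const2) (auto simp: contractive_def pmass_def)
qed

text \<open>
  The Yosida approximation of the negative Jacobi operator is \<open>n (1 - r)\<close> with the resolvent
  \<open>r = 1 / (1 + \<lambda> / n)\<close>. Its Bessel multiplier \<open>((n + 1) - n r) powr (- \<sigma>)\<close> is, by the binomial
  series, the limit of subconvex combinations of powers of \<open>r\<close>; letting \<open>n\<close> tend to infinity
  gives the claim.
\<close>

lemma contractive_bessel:
  assumes p: "1 < p" and \<sigma>: "0 < \<sigma>"
  shows "contractive p (\<lambda>\<kappa>. (1 + ev \<kappa>) powr (- \<sigma>))"
proof (rule contractive_limit)
  fix N :: nat
  define n where "n = real (Suc N)"
  have n: "n > 0" by (simp add: n_def)
  define r where "r \<kappa> = 1 / (1 + (1 / n) * ev \<kappa>)" for \<kappa>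
  have r: "contractive p r"
    unfolding r_def using n by (intro contractive_resolvent p) auto
  have pos: "1 + (1 / n) * ev \<kappa> > 0" "1 + (1 / n) * ev \<kappa> \<ge> 1" for \<kappa>
    using n eigenvalue_nonneg[of \<kappa>] by (auto intro!: add_pos_nonneg)
  have r01: "0 < r \<kappa>" "r \<kappa> \<le> 1" for \<kappa>
    using pos[of \<kappa>] unfolding r_def by auto
  define w where "w k = (n + 1) powr (- \<sigma>) * ((pochhammer \<sigma> k / fact k) * (n / (n + 1)) ^ k)" for k
  have w0: "0 \<le> w k" for k
    unfolding w_def using \<sigma> n by (intro mult_nonneg_nonneg divide_nonneg_nonneg pochhammer_nonneg) auto
  \<comment> \<open>The binomial coefficient of \<open>- \<sigma>\<close> over \<open>k\<close> has the sign of \<open>(-1) ^ k\<close>, which cancels against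
      the sign of the argument \<open>- n t / (n + 1)\<close>; this is why the weights \<open>w k\<close> are nonnegative.\<close>
  have sums: "(\<lambda>k. w k * t ^ k) sums ((n + 1) - n * t) powr (- \<sigma>)" if t: "0 < t" "t \<le> 1" for t
  proof -
    define z where "z = n / (n + 1) * t"
    have "z \<le> n / (n + 1) * 1" unfolding z_def using t n by (intro mult_left_mono) auto
    also have "\<dots> < 1" using n by auto
    finally have z: "0 < z" "z < 1" using t n by (auto simp: z_def)
    have "(\<lambda>k. (- \<sigma> gchoose k) * (- z) ^ k) sums (1 + - z) powr (- \<sigma>)"
      using z by (intro gen_binomial_real) auto
    moreover have "(- \<sigma> gchoose k) * (- z) ^ k = pochhammer \<sigma> k / fact k * z ^ k" for k
    proof -
      have "(-1::real) ^ k * (- z) ^ k = z ^ k" by (simp flip: power_mult_distrib)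
      then show ?thesis
        by (simp add: gbinomial_pochhammer field_simps)
    qed
    ultimately have "(\<lambda>k. pochhammer \<sigma> k / fact k * z ^ k) sums (1 - z) powr (- \<sigma>)" by simp
    then have "(\<lambda>k. (n + 1) powr (- \<sigma>) * (pochhammer \<sigma> k / fact k * z ^ k)) sums ((n + 1) powr (- \<sigma>) * (1 - z) powr (- \<sigma>))"
      by (rule sums_mult)
    moreover have "(n + 1) powr (- \<sigma>) * (1 - z) powr (- \<sigma>) = ((n + 1) * (1 - z)) powr (- \<sigma>)"
      using n z by (simp add: powr_mult)
    moreover have "(n + 1) * (1 - z) = (n + 1) - n * t"
      using n by (simp add: z_def field_simps)
    ultimately show ?thesis
      by (simp add: w_def z_def power_mult_distrib power_divide mult_ac)
  qed
  have sum1: "w sums 1"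
    using sums[of 1] by simp
  show "contractive p (\<lambda>\<kappa>. ((n + 1) - n * r \<kappa>) powr (- \<sigma>))"
  proof (rule contractive_limit)
    fix J :: nat
    have "(\<Sum>k<J. w k) \<le> 1"
      using sum_le_suminf[of w "{..<J}"] sum1 w0 by (auto simp: sums_iff)
    then show "contractive p (\<lambda>\<kappa>. \<Sum>k<J. w k * r \<kappa> ^ k)"
      using w0 by (intro contractive_convex p contractive_power r) auto
    show "(\<lambda>J. \<Sum>k<J. w k * r \<kappa> ^ k) \<longlonglongrightarrow> ((n + 1) - n * r \<kappa>) powr (- \<sigma>)" for \<kappa>
      using sums[OF r01] by (simp add: sums_def)
  qed (use p in auto)
next
  fix \<kappa>
  let ?l = "ev \<kappa>"
  have "((\<lambda>n::nat. ((real (Suc n) + 1) - real (Suc n) * (1 / (1 + 1 / real (Suc n) * ?l))) powr (- \<sigma>))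
      \<longlonglongrightarrow> (1 + ?l) powr (- \<sigma>))"
  proof (rule tendsto_powr)
    have "(\<lambda>n. 1 + ?l / (1 + ?l * (1 / real (Suc n)))) \<longlonglongrightarrow> 1 + ?l / (1 + ?l * 0)"
      by (intro tendsto_intros LIMSEQ_Suc[OF lim_1_over_n]) auto
    moreover have eq: "(real (Suc n) + 1) - real (Suc n) * (1 / (1 + 1 / real (Suc n) * ?l)) = 1 + ?l / (1 + ?l * (1 / real (Suc n)))" for n
    proof -
      have "real (Suc n) + ?l > 0" using eigenvalue_nonneg[of \<kappa>] by auto
      then show ?thesis
        by (simp add: divide_simps) (simp add: algebra_simps)
    qed
    ultimately show "(\<lambda>n. (real (Suc n) + 1) - real (Suc n) * (1 / (1 + 1 / real (Suc n) * ?l))) \<longlonglongrightarrow> 1 + ?l"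
      unfolding eq by simp
    show "1 + ?l \<noteq> 0" using eigenvalue_nonneg[of \<kappa>] by linarith
  qed auto
  then show "(\<lambda>N. ((real (Suc N) + 1) - real (Suc N) * (1 / (1 + 1 / real (Suc N) * ?l))) powr (- \<sigma>))
      \<longlonglongrightarrow> (1 + ?l) powr (- \<sigma>)" .
qed (use p in auto)

section \<open>The Bessel potential as a multiplier\<close>

text \<open>
  Each summand of the eigenvalue is nonnegative and at least \<open>\<kappa>\<^sub>i\<^sup>2 \<ge> \<kappa>\<^sub>i\<close>.
\<close>

lemma finite_eigenvalue_le: "finite {\<kappa>. ev \<kappa> \<le> B}"
proof -
  define m where "m = nat \<lfloor>B\<rfloor>"
  have "\<kappa> $ i \<le> m" if "ev \<kappa> \<le> B" for \<kappa> i
  proof -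
    let ?t = "\<lambda>i. real (\<kappa> $ i) * (real (\<kappa> $ i) + \<alpha> $ i + \<beta> $ i + 1)"
    have t: "0 \<le> ?t j" for j
      using alpha_beta[of j] by (intro mult_nonneg_nonneg) auto
    have "real (\<kappa> $ i) \<le> real (\<kappa> $ i) * real (\<kappa> $ i)"
      by (cases "\<kappa> $ i") auto
    also have "\<dots> \<le> ?t i"
      using alpha_beta[of i] by (intro mult_left_mono) auto
    also have "\<dots> \<le> ev \<kappa>"
      unfolding jacobi_eigenvalue_def by (rule member_le_sum) (use t in auto)
    finally have "real (\<kappa> $ i) \<le> B" using that by simp
    then show ?thesis unfolding m_def by linarith
  qed
  then have "{\<kappa>. ev \<kappa> \<le> B} \<subseteq> vec_lambda ` (Pi\<^sub>E UNIV (\<lambda>_. {..m}))"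
    by (auto intro!: image_eqI[of _ _ "vec_nth x" for x])
  then show ?thesis
    by (rule finite_subset) (intro finite_imageI finite_PiE, auto)
qed

lemma jacobi_level_enumerates:
  "strict_mono (jacobi_level \<alpha> \<beta>)" "range (jacobi_level \<alpha> \<beta>) = range ev"
proof -
  have "infinite (range ev)"
  proof
    assume "finite (range ev)"
    then have "UNIV = {\<kappa>. ev \<kappa> \<le> Max (range ev)}" by auto
    then have "finite (UNIV :: (nat ^ 'd) set)" using finite_eigenvalue_le by metis
    then show False using infinite_UNIV_vec[where 'a = nat and 'b = 'd] by simp
  qed
  moreover have "finite {x \<in> range ev. x \<le> B}" for B
  proof -
    have "{x \<in> range ev. x \<le> B} = ev ` {\<kappa>. ev \<kappa> \<le> B}" by auto
    then show ?thesis using finite_eigenvalue_le by simp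
  qed
  ultimately have "\<exists>r::nat \<Rightarrow> real. strict_mono r \<and> range r = range ev"
    by (rule strict_mono_enumeration_exists)
  then obtain r :: "nat \<Rightarrow> real" where r: "strict_mono r \<and> range r = range ev" ..
  have "jacobi_level \<alpha> \<beta> = r"
    unfolding jacobi_level_def
  proof (rule the_equality)
    show "s = r" if "strict_mono s \<and> range s = range ev" for s
      using that r by (intro strict_mono_enumeration_unique) auto
  qed (rule r)
  with r show "strict_mono (jacobi_level \<alpha> \<beta>)" "range (jacobi_level \<alpha> \<beta>) = range ev" by auto
qed

lemma jacobi_coeff_expansion:
  assumes "finite K"
  shows "jacobi_coeff \<alpha> \<beta> (expansion K c) \<kappa>' = (if \<kappa>' \<in> K then c \<kappa>' else 0)"
proof -
  have "jacobi_coeff \<alpha> \<beta> (expansion K c) \<kappa>' = (\<integral>x. (\<Sum>\<kappa>\<in>K. c \<kappa> * (e \<kappa> x * e \<kappa>' x)) \<partial>\<mu>)"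
    by (simp add: jacobi_coeff_def expansion_def sum_distrib_right mult.assoc)
  also have "\<dots> = (\<Sum>\<kappa>\<in>K. \<integral>x. c \<kappa> * (e \<kappa> x * e \<kappa>' x) \<partial>\<mu>)"
    by (intro Bochner_Integration.integral_sum integrable_jacobi continuous_intros)
  also have "\<dots> = (\<Sum>\<kappa>\<in>K. if \<kappa> = \<kappa>' then c \<kappa> else 0)"
    by (intro sum.cong refl) (simp add: jacobi_vec_orthonormal)
  finally show ?thesis using assms by (simp add: sum.delta')
qed

text \<open>
  Only finitely many levels meet \<open>K\<close>, so the series is a finite sum; grouping \<open>K\<close> by the level
  \<open>\<nu> \<kappa>\<close> of its elements turns it into a sum over \<open>K\<close>.
\<close>

lemma bessel_potential_expansion:
  assumes K: "finite K"
  shows "bessel_potential \<alpha> \<beta> \<gamma> (expansion K c) = expansion K (\<lambda>\<kappa>. (1 + ev \<kappa>) powr (- \<gamma> / 2) * c \<kappa>)"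
proof
  fix x
  let ?lev = "jacobi_level \<alpha> \<beta>"
  have "\<exists>n. ?lev n = ev \<kappa>" for \<kappa>
    using jacobi_level_enumerates(2) by (metis imageE rangeI)
  then obtain \<nu> where \<nu>: "\<And>\<kappa>. ?lev (\<nu> \<kappa>) = ev \<kappa>" by metis
  have \<nu>_iff: "ev \<kappa> = ?lev n \<longleftrightarrow> \<nu> \<kappa> = n" for \<kappa> n
    using strict_mono_eq[OF jacobi_level_enumerates(1)] \<nu> by metis
  have proj: "jacobi_proj \<alpha> \<beta> n (expansion K c) x = (\<Sum>\<kappa>\<in>{\<kappa>\<in>K. \<nu> \<kappa> = n}. c \<kappa> * e \<kappa> x)" for n
  proof -
    have A: "jacobi_index_set \<alpha> \<beta> n = {\<kappa>. \<nu> \<kappa> = n}"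
      by (auto simp: jacobi_index_set_def \<nu>_iff)
    have "finite {\<kappa>. \<nu> \<kappa> = n}"
      by (rule finite_subset[OF _ finite_eigenvalue_le[of "?lev n"]]) (auto simp flip: \<nu>_iff)
    then show ?thesis
      unfolding jacobi_proj_def A jacobi_coeff_expansion[OF K]
      by (intro sum.mono_neutral_cong_right) auto
  qed
  let ?t = "\<lambda>\<kappa>. (1 + ev \<kappa>) powr (- \<gamma> / 2) * c \<kappa> * e \<kappa> x"
  have summand: "(1 + ?lev n) powr (- \<gamma> / 2) * jacobi_proj \<alpha> \<beta> n (expansion K c) x = (\<Sum>\<kappa>\<in>{\<kappa>\<in>K. \<nu> \<kappa> = n}. ?t \<kappa>)" for n
    unfolding proj sum_distrib_left by (intro sum.cong refl) (auto simp: mult.assoc simp flip: \<nu>)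
  have "bessel_potential \<alpha> \<beta> \<gamma> (expansion K c) x = (\<Sum>n\<in>\<nu> ` K. \<Sum>\<kappa>\<in>{\<kappa>\<in>K. \<nu> \<kappa> = n}. ?t \<kappa>)"
    unfolding bessel_potential_def summand
  proof (rule suminf_finite)
    fix n assume "n \<notin> \<nu> ` K"
    then have empty: "{\<kappa>\<in>K. \<nu> \<kappa> = n} = {}" by auto
    show "(\<Sum>\<kappa>\<in>{\<kappa>\<in>K. \<nu> \<kappa> = n}. ?t \<kappa>) = 0"
      unfolding empty by simp
  qed (use K in simp)
  also have "\<dots> = (\<Sum>\<kappa>\<in>K. ?t \<kappa>)"
    using sum.image_gen[OF K, of ?t \<nu>] by simp
  finally show "bessel_potential \<alpha> \<beta> \<gamma> (expansion K c) x = expansion K (\<lambda>\<kappa>. (1 + ev \<kappa>) powr (- \<gamma> / 2) * c \<kappa>) x"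
    by (simp add: expansion_def)
qed

section \<open>Every polynomial is a finite Jacobi expansion\<close>

definition expansions :: "(real ^ 'd \<Rightarrow> real) set" where
  "expansions = {f. \<exists>K c. finite K \<and> f = expansion K c}"

lemma expansion_enlarge:
  assumes "finite L" "K \<subseteq> L"
  shows "expansion K c = expansion L (\<lambda>\<kappa>. if \<kappa> \<in> K then c \<kappa> else 0)"
  unfolding expansion_def using assms by (intro ext sum.mono_neutral_cong_left) auto

lemma expansions_common:
  assumes "f \<in> expansions" "g \<in> expansions"
  obtains K c d where "finite K" "f = expansion K c" "g = expansion K d"
proof -
  obtain K L c d where K: "finite K" "f = expansion K c" and L: "finite L" "g = expansion L d"
    using assms by (auto simp: expansions_def)
  show ?thesis
    using expansion_enlarge[of "K \<union> L" K c] expansion_enlarge[of "K \<union> L" L d] K L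
    by (intro that[of "K \<union> L"]) auto
qed

lemma expansion_lincomb:
  "(\<lambda>x. a * expansion K c x + b * expansion K d x) = expansion K (\<lambda>\<kappa>. a * c \<kappa> + b * d \<kappa>)"
  by (auto simp: expansion_def sum_distrib_left sum.distrib algebra_simps)

lemma expansions_lincomb:
  assumes "f \<in> expansions" "g \<in> expansions"
  shows "(\<lambda>x. a * f x + b * g x) \<in> expansions"
proof -
  obtain K c d where "finite K" "f = expansion K c" "g = expansion K d"
    using expansions_common[OF assms] .
  then show ?thesis
    using expansion_lincomb[of a K c b d] unfolding expansions_def by blast
qed

lemma zero_in_expansions: "(\<lambda>x. 0) \<in> expansions"
proof -
  have "(\<lambda>x. 0) = expansion {} (\<lambda>_. 0)" by (auto simp: expansion_def)
  then show ?thesis unfolding expansions_def by blast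
qed

lemma jacobi_vec_in_expansions: "e \<kappa> \<in> expansions"
proof -
  have "e \<kappa> = expansion {\<kappa>} (\<lambda>_. 1)" by (auto simp: expansion_def)
  then show ?thesis unfolding expansions_def by blast
qed

lemma expansions_sum:
  assumes "finite J" "\<And>j. j \<in> J \<Longrightarrow> f j \<in> expansions"
  shows "(\<lambda>x. \<Sum>j\<in>J. w j * f j x) \<in> expansions"
  using assms
proof (induction J)
  case empty
  then show ?case using zero_in_expansions by simp
next
  case (insert j J)
  then have "(\<lambda>x. w j * f j x + 1 * (\<Sum>j\<in>J. w j * f j x)) \<in> expansions"
    by (intro expansions_lincomb) auto
  then show ?case using insert by simp
qed

text \<open>
  The \<open>i\<close>-th factor times \<open>x\<^sub>i\<close> is a polynomial in \<open>x\<^sub>i\<close> and hence a combination of the Jacobi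
  polynomials of that coordinate. Together with \<open>one_in_expansions\<close> this gives all polynomials,
  because they are generated from constants by sums and products with linear functions.
\<close>

lemma coordinate_times_jacobi_vec: "(\<lambda>x. x $ i * e \<kappa> x) \<in> expansions"
proof -
  let ?P = "\<lambda>i n. jacobi_poly n (\<alpha> $ i) (\<beta> $ i)"
  let ?n = "Suc (\<kappa> $ i)"
  define u where "u j = (\<chi> k. if k = i then j else \<kappa> $ k)" for j
  have "degree (pCons 0 (?P i (\<kappa> $ i))) \<le> ?n"
    using degree_pCons_le[of 0 "?P i (\<kappa> $ i)"] jacobi_poly_degree[OF alpha[of i] beta[of i] alpha_beta[of i], of "\<kappa> $ i"] by simp
  from jacobi_poly_span[OF alpha beta alpha_beta this]
  obtain d where d: "pCons 0 (?P i (\<kappa> $ i)) = (\<Sum>j\<le>?n. smult (d j) (?P i j))" by blast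
  have split: "e \<kappa>' x = poly (?P i (\<kappa>' $ i)) (x $ i) * (\<Prod>k\<in>UNIV-{i}. poly (?P k (\<kappa>' $ k)) (x $ k))" for \<kappa>' x
    unfolding jacobi_vec_def by (rule prod.remove) auto
  have "x $ i * e \<kappa> x = (\<Sum>j\<le>?n. d j * e (u j) x)" for x
  proof -
    let ?R = "\<Prod>k\<in>UNIV-{i}. poly (?P k (\<kappa> $ k)) (x $ k)"
    have "x $ i * e \<kappa> x = poly (pCons 0 (?P i (\<kappa> $ i))) (x $ i) * ?R"
      by (simp add: split)
    also have "\<dots> = (\<Sum>j\<le>?n. d j * (poly (?P i j) (x $ i) * ?R))"
      unfolding d by (simp add: poly_sum sum_distrib_right mult.assoc del: sum.atMost_Suc)
    also have "\<dots> = (\<Sum>j\<le>?n. d j * e (u j) x)"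
    proof (intro sum.cong refl)
      fix j
      have "(\<Prod>k\<in>UNIV-{i}. poly (?P k (u j $ k)) (x $ k)) = ?R"
        by (intro prod.cong refl) (auto simp: u_def)
      then show "d j * (poly (?P i j) (x $ i) * ?R) = d j * e (u j) x"
        by (simp add: split) (simp add: u_def)
    qed
    finally show ?thesis .
  qed
  then show ?thesis
    using expansions_sum[of "{..?n}" "\<lambda>j. e (u j)" d] jacobi_vec_in_expansions by simp
qed

lemma coordinate_times_expansions:
  assumes "f \<in> expansions"
  shows "(\<lambda>x. x $ i * f x) \<in> expansions"
proof -
  obtain K c where K: "finite K" "f = expansion K c" using assms by (auto simp: expansions_def)
  have "(\<lambda>x. \<Sum>\<kappa>\<in>K. c \<kappa> * (x $ i * e \<kappa> x)) \<in> expansions"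
    by (intro expansions_sum K coordinate_times_jacobi_vec)
  also have "(\<lambda>x. \<Sum>\<kappa>\<in>K. c \<kappa> * (x $ i * e \<kappa> x)) = (\<lambda>x. x $ i * f x)"
    by (auto simp: K expansion_def sum_distrib_left mult_ac)
  finally show ?thesis .
qed

lemma polynomial_times_expansions:
  assumes "real_polynomial_function g" "f \<in> expansions"
  shows "(\<lambda>x. g x * f x) \<in> expansions"
  using assms
proof (induction g arbitrary: f)
  case (linear g)
  note lin = linear.hyps and f = linear.prems
  interpret bounded_linear g by (rule lin)
  have g_eq: "g x = (\<Sum>i\<in>UNIV. g (axis i 1) * x $ i)" for x
  proof -
    have "g x = g (\<Sum>i\<in>UNIV. x $ i *\<^sub>R axis i 1)"
      by (simp add: basis_expansion flip: scalar_mult_eq_scaleR)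
    also have "\<dots> = (\<Sum>i\<in>UNIV. g (axis i 1) * x $ i)"
      by (simp add: sum scaleR mult.commute)
    finally show ?thesis .
  qed
  have "(\<lambda>x. g x * f x) = (\<lambda>x. \<Sum>i\<in>UNIV. g (axis i 1) * (x $ i * f x))"
    by (rule ext, subst g_eq) (simp add: sum_distrib_right mult.assoc)
  also have "\<dots> \<in> expansions"
    by (intro expansions_sum coordinate_times_expansions f) auto
  finally show ?case .
next
  case (const c)
  show ?case using expansions_lincomb[OF const const, of c 0] by simp
next
  case (add g h)
  have "(\<lambda>x. 1 * (g x * f x) + 1 * (h x * f x)) \<in> expansions"
    by (intro expansions_lincomb add.IH add.prems)
  then show ?case by (simp add: distrib_right)
next
  case (mult g h)
  have "(\<lambda>x. g x * (h x * f x)) \<in> expansions"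
    by (intro mult.IH mult.prems)
  then show ?case by (simp add: mult.assoc)
qed

lemma one_in_expansions: "(\<lambda>x. 1) \<in> expansions"
proof -
  have "\<exists>v. v \<noteq> 0 \<and> jacobi_poly 0 (\<alpha> $ i) (\<beta> $ i) = [:v:]" for i
  proof -
    obtain v where v: "jacobi_poly 0 (\<alpha> $ i) (\<beta> $ i) = [:v:]"
      by (rule degree_eq_zeroE[OF jacobi_poly_degree[OF alpha beta alpha_beta]])
    then show ?thesis using jacobi_poly_nonzero[OF alpha[of i] beta[of i] alpha_beta, of 0] by auto
  qed
  then obtain v where v: "\<And>i. v i \<noteq> 0" "\<And>i. jacobi_poly 0 (\<alpha> $ i) (\<beta> $ i) = [:v i:]" by metis
  let ?V = "\<Prod>i\<in>UNIV. v i"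
  have "e 0 x = ?V" for x by (simp add: jacobi_vec_def v(2))
  moreover have "?V \<noteq> 0" using v(1) by simp
  ultimately show ?thesis
    using expansions_lincomb[OF jacobi_vec_in_expansions jacobi_vec_in_expansions, of "1 / ?V" 0 0 0] by simp
qed

lemma polynomial_in_expansions:
  assumes "real_polynomial_function f"
  shows "f \<in> expansions"
  using polynomial_times_expansions[OF assms one_in_expansions] by simp

lemma bessel_potential_bounded:
  assumes p: "1 < p" and \<gamma>: "0 < \<gamma>"
  shows "\<exists>T. continuous_Lp_operator p \<mu> T \<and>
             (\<forall>f. real_polynomial_function f \<longrightarrow> (AE x in \<mu>. T f x = bessel_potential \<alpha> \<beta> \<gamma> f x))"
proof -
  let ?B = "bessel_potential \<alpha> \<beta> \<gamma>"
  let ?S = "Collect real_polynomial_function :: (real ^ 'd \<Rightarrow> real) set"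
  have "\<exists>T. continuous_Lp_operator p \<mu> T \<and> (\<forall>f\<in>?S. AE x in \<mu>. T f x = ?B f x)"
  proof (rule Lp_operator_extension[OF finite_measure_jacobi])
    show "1 \<le> p" using p by simp
    show "?S \<subseteq> Lp_space p \<mu>"
      using polynomial_in_expansions expansion_Lp p by (fastforce simp: expansions_def)
    show "(\<lambda>x. a * f x + b * g x) \<in> ?S" if "f \<in> ?S" "g \<in> ?S" for f g a b
      using that by (intro CollectI real_polynomial_function.intros(2-4)) auto
    show "\<exists>q\<in>?S. pmass p \<mu> (\<lambda>x. f x - q x) < d" if "f \<in> Lp_space p \<mu>" "0 < d" for f d
    proof -
      have ac: "absolutely_continuous lborel \<mu>"
        unfolding jacobi_measure_def
        by (rule absolutely_continuousI_density) measurable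
      have "\<exists>q. real_polynomial_function q \<and> pmass p \<mu> (\<lambda>x. f x - q x) < d"
        by (rule polynomials_dense_Lp[OF finite_measure_jacobi _ ac _ AE_jacobi_cube _ that]) (use p in auto)
      then show ?thesis by auto
    qed
    have B: "\<exists>K c. finite K \<and> q = expansion K c \<and> ?B q = expansion K (\<lambda>\<kappa>. (1 + ev \<kappa>) powr (- \<gamma> / 2) * c \<kappa>)"
      if "q \<in> ?S" for q
    proof -
      obtain K c where "finite K" "q = expansion K c"
        using polynomial_in_expansions[of q] \<open>q \<in> ?S\<close> by (auto simp: expansions_def)
      then show ?thesis using bessel_potential_expansion by blast
    qed
    show "?B q \<in> Lp_space p \<mu>" if "q \<in> ?S" for q
      using B[OF that] expansion_Lp p by auto
    show "pmass p \<mu> (?B q) \<le> pmass p \<mu> q" if "q \<in> ?S" for q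
    proof -
      obtain K c where K: "finite K" "q = expansion K c" "?B q = expansion K (\<lambda>\<kappa>. (1 + ev \<kappa>) powr (- (\<gamma> / 2)) * c \<kappa>)"
        using B[OF \<open>q \<in> ?S\<close>] by auto
      show ?thesis
        unfolding K(3) unfolding K(2) using \<gamma> by (intro contractiveD contractive_bessel p K) simp
    qed
    show "?B (\<lambda>x. a * f x + b * g x) = (\<lambda>x. a * ?B f x + b * ?B g x)" if "f \<in> ?S" "g \<in> ?S" for f g a b
    proof -
      have "f \<in> expansions" "g \<in> expansions" using that polynomial_in_expansions by auto
      then obtain K c d where K: "finite K" "f = expansion K c" "g = expansion K d"
        by (rule expansions_common)
      show ?thesis
        unfolding K expansion_lincomb bessel_potential_expansion[OF K(1)]
        by (simp add: algebra_simps)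
    qed
  qed
  then show ?thesis by auto
qed

end

theorem theorem3p4:
  fixes \<alpha> \<beta> :: "real ^ 'd::finite" and \<gamma> p :: real
  assumes "\<And>i. \<alpha> $ i > - 1 / 2" and "\<And>i. \<beta> $ i > - 1 / 2"
    and "\<gamma> > 0" and "1 < p"
  shows "\<exists>T. continuous_Lp_operator p (jacobi_measure \<alpha> \<beta>) T \<and>
             (\<forall>f. real_polynomial_function f \<longrightarrow>
                (AE x in jacobi_measure \<alpha> \<beta>. T f x = bessel_potential \<alpha> \<beta> \<gamma> f x))"
proof -
  interpret jacobi \<alpha> \<beta>
  proof
    fix i
    show "\<alpha> $ i > -1" "\<beta> $ i > -1" "\<alpha> $ i + \<beta> $ i > -1"
      using assms(1)[of i] assms(2)[of i] by linarith+
  qed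
  show ?thesis using assms(4,3) by (rule bessel_potential_bounded)
qed

end
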